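(* In the setting of the context, assume that (i) $\sum_{k\ge 0}\|\mathbb{E}(X_k\mid\mathcal{F}_0)\|_2^2<\infty$, and (ii) $\mathbb{E}(X_0\mid\mathcal{F}_{-\infty})=0$ a.s. and $\sum_{k\ge0}\|P_0(X_k)\|_2<\infty$. Then the $\mathbb{L}^2_0$-MMA property holds. Moreover, the random variable $D$ in that property is $D=\sum_{k=0}^\infty P_0(X_k)$.
   Context: Let $(\Omega,\mathcal{A},\mathbb{P})$ be a probability space and $T:\Omega\to\Omega$ a bijective bimeasurable transformation preserving $\mathbb{P}$. Let $\mathcal{F}_0\subseteq\mathcal{A}$ be a $\sigma$-algebra with $\mathcal{F}_0\subseteq T^{-1}(\mathcal{F}_0)$, let $\mathcal{F}_i=T^{-i}(\mathcal{F}_0)$ for $i\in\mathbb{Z}$, and $\mathcal{F}_{-\infty}=\bigcap_{i\in\mathbb{Z}}\mathcal{F}_i$. Let $X_0$ be an $\mathcal{F}_0$-measurable, square integrable, centered real random variable, $X_i=X_0\circ T^i$ for $i\in\mathbb{Z}$, and $S_n=X_1+\cdots+X_n$. Write $\|\cdot\|_2$ for the norm of $\mathbb{L}^2(\mathbb{P})$ and $P_0(X_k)=\mathbb{E}(X_k\mid\mathcal{F}_0)-\mathbb{E}(X_k\mid\mathcal{F}_{-1})$. The $\mathbb{L}^2_0$-MMA property (maximal martingale approximation in $\mathbb{L}^2(\mathcal{F}_0)$) means: there exists a (necessarily unique) $\mathcal{F}_0$-measurable random variable $D\in\mathbb{L}^2$ such that $\mathbb{E}(D\circ T\mid\mathcal{F}_0)=0$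 a.s. and $$\lim_{n\to\infty}\frac1n\,\mathbb{E}\left(\max_{1\le k\le n}\Big(S_k-\sum_{i=1}^kD\circ T^i\Big)^2\,\Big|\,\mathcal{F}_0\right)=0\quad\text{almost surely and in }\mathbb{L}^1.$$ *)

theory Defs
  imports "HOL-Probability.Probability"
begin

text \<open>
  Integer powers of a bijection \<open>T\<close> of \<open>space M\<close>. The values outside \<open>space M\<close> are irrelevant.
\<close>

definition iter_int :: "'a measure \<Rightarrow> ('a \<Rightarrow> 'a) \<Rightarrow> int \<Rightarrow> 'a \<Rightarrow> 'a" where
  "iter_int M T i =
     (if i \<ge> 0 then T ^^ nat i else the_inv_into (space M) T ^^ nat (- i))"

definition bimeasurable_mpt :: "'a measure \<Rightarrow> ('a \<Rightarrow> 'a) \<Rightarrow> bool" where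
  "bimeasurable_mpt M T \<longleftrightarrow>
     bij_betw T (space M) (space M) \<and>
     T \<in> M \<rightarrow>\<^sub>M M \<and>
     the_inv_into (space M) T \<in> M \<rightarrow>\<^sub>M M \<and>
     distr M M T = M"

text \<open>
  A sub-\<open>\<sigma>\<close>-algebra is represented, as in the library, by a measure of which only the space and
  the measurable sets matter (\<^const>\<open>subalgebra\<close>). Thus \<open>filt M T F0 i\<close> is \<open>T\<^sup>-\<^sup>i(F0)\<close>.
\<close>

definition filt :: "'a measure \<Rightarrow> ('a \<Rightarrow> 'a) \<Rightarrow> 'a measure \<Rightarrow> int \<Rightarrow> 'a measure" where
  "filt M T F0 i = vimage_algebra (space M) (iter_int M T i) F0"

definition filt_minus_inf :: "'a measure \<Rightarrow> ('a \<Rightarrow> 'a) \<Rightarrow> 'a measure \<Rightarrow> 'a measure" where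
  "filt_minus_inf M T F0 = sigma (space M) (\<Inter>i. sets (filt M T F0 i))"

definition stat_seq :: "'a measure \<Rightarrow> ('a \<Rightarrow> 'a) \<Rightarrow> ('a \<Rightarrow> real) \<Rightarrow> int \<Rightarrow> 'a \<Rightarrow> real" where
  "stat_seq M T X0 i = X0 \<circ> iter_int M T i"

definition partial_sum :: "'a measure \<Rightarrow> ('a \<Rightarrow> 'a) \<Rightarrow> ('a \<Rightarrow> real) \<Rightarrow> nat \<Rightarrow> 'a \<Rightarrow> real" where
  "partial_sum M T X0 n x = (\<Sum>i=1..n. stat_seq M T X0 (int i) x)"

definition proj0 :: "'a measure \<Rightarrow> ('a \<Rightarrow> 'a) \<Rightarrow> 'a measure \<Rightarrow> ('a \<Rightarrow> real) \<Rightarrow> 'a \<Rightarrow> real" where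
  "proj0 M T F0 Y x = real_cond_exp M F0 Y x - real_cond_exp M (filt M T F0 (-1)) Y x"

definition in_L2 :: "'a measure \<Rightarrow> ('a \<Rightarrow> real) \<Rightarrow> bool" where
  "in_L2 M f \<longleftrightarrow> f \<in> borel_measurable M \<and> integrable M (\<lambda>x. (f x)\<^sup>2)"

text \<open>Meaningful only for \<open>f\<close> satisfying \<^const>\<open>in_L2\<close>.\<close>

definition norm_L2 :: "'a measure \<Rightarrow> ('a \<Rightarrow> real) \<Rightarrow> real" where
  "norm_L2 M f = sqrt (\<integral>x. (f x)\<^sup>2 \<partial>M)"

definition sums_L2 :: "'a measure \<Rightarrow> (nat \<Rightarrow> 'a \<Rightarrow> real) \<Rightarrow> ('a \<Rightarrow> real) \<Rightarrow> bool" where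
  "sums_L2 M f g \<longleftrightarrow>
     (\<forall>k. in_L2 M (f k)) \<and> in_L2 M g \<and>
     (\<lambda>n. norm_L2 M (\<lambda>x. (\<Sum>k<n. f k x) - g x)) \<longlonglongrightarrow> 0"

definition tendsto_L1 :: "'a measure \<Rightarrow> (nat \<Rightarrow> 'a \<Rightarrow> real) \<Rightarrow> ('a \<Rightarrow> real) \<Rightarrow> bool" where
  "tendsto_L1 M f g \<longleftrightarrow>
     (\<forall>n. integrable M (f n)) \<and> integrable M g \<and>
     (\<lambda>n. \<integral>x. \<bar>f n x - g x\<bar> \<partial>M) \<longlonglongrightarrow> 0"

text \<open>
  For \<open>n = 0\<close> the maximum is over the empty set, but the factor \<open>1 / real 0 = 0\<close> makes the
  whole expression vanish.
\<close>

definition mma_error ::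
  "'a measure \<Rightarrow> ('a \<Rightarrow> 'a) \<Rightarrow> 'a measure \<Rightarrow> ('a \<Rightarrow> real) \<Rightarrow> ('a \<Rightarrow> real) \<Rightarrow> nat \<Rightarrow> 'a \<Rightarrow> real" where
  "mma_error M T F0 X0 D n x =
     1 / real n * real_cond_exp M F0
       (\<lambda>y. MAX k\<in>{1..n}. (partial_sum M T X0 k y - (\<Sum>i=1..k. D (iter_int M T (int i) y)))\<^sup>2) x"

definition mma_witness ::
  "'a measure \<Rightarrow> ('a \<Rightarrow> 'a) \<Rightarrow> 'a measure \<Rightarrow> ('a \<Rightarrow> real) \<Rightarrow> ('a \<Rightarrow> real) \<Rightarrow> bool" where
  "mma_witness M T F0 X0 D \<longleftrightarrow>
     D \<in> borel_measurable F0 \<and> in_L2 M D \<and>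
     (AE x in M. real_cond_exp M F0 (D \<circ> T) x = 0) \<and>
     (AE x in M. (\<lambda>n. mma_error M T F0 X0 D n x) \<longlonglongrightarrow> 0) \<and>
     tendsto_L1 M (mma_error M T F0 X0 D) (\<lambda>_. 0)"

definition L20_MMA ::
  "'a measure \<Rightarrow> ('a \<Rightarrow> 'a) \<Rightarrow> 'a measure \<Rightarrow> ('a \<Rightarrow> real) \<Rightarrow> bool" where
  "L20_MMA M T F0 X0 \<longleftrightarrow> (\<exists>D. mma_witness M T F0 X0 D)"

end

theory Submission
  imports Defs
begin

text \<open>
  Write \<open>E\<^sub>0\<close> for conditioning on \<open>F\<^sub>0\<close>, \<open>a\<^sub>i = E\<^sub>0(X\<^sub>i)\<close>, \<open>d\<^sub>j = P\<^sub>0(X\<^sub>j)\<close> and \<open>D = \<Sum>\<^sub>j d\<^sub>j\<close>. Since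
  \<open>d\<^sub>j \<circ> T = a\<^sub>j \<circ> T - a\<^sub>j\<^sub>+\<^sub>1\<close>, a telescoping sum gives \<open>X\<^sub>i = a\<^sub>i + \<Sum>\<^sub>1\<^sub>\<le>\<^sub>l\<^sub>\<le>\<^sub>i d\<^sub>i\<^sub>-\<^sub>l \<circ> T\<^sup>l\<close>. For fixed \<open>j\<close> the sums
  \<open>N\<^sub>j(k) = \<Sum>\<^sub>l\<^sub>\<le>\<^sub>k d\<^sub>j \<circ> T\<^sup>l\<close> form a martingale in \<open>k\<close>, and exchanging the order of summation yields
  \<open>S\<^sub>k - \<Sum>\<^sub>i\<^sub>\<le>\<^sub>k D \<circ> T\<^sup>i = \<Sum>\<^sub>i\<^sub>\<le>\<^sub>k a\<^sub>i - \<Sum>\<^sub>j (N\<^sub>j(k) - N\<^sub>j(k - j))\<close>, where \<open>N\<^sub>j(k - j) = 0\<close> for \<open>j \<ge> k\<close>.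

  The squared maximum over \<open>k \<le> n\<close> is bounded in three parts. The sum of the \<open>a\<^sub>i\<close> contributes a fixed
  function plus \<open>n\<close> times a tail of \<open>\<Sum> a\<^sub>i\<^sup>2\<close>, which is integrable by condition (i). For \<open>j < J\<close> only the
  last \<open>J\<close> times before \<open>k\<close> survive the cancellation, and truncation at a level \<open>K\<close> leaves, besides a
  constant, a sum over \<open>l \<le> n\<close> of large values of a square integrable function. For \<open>j \<ge> J\<close> the
  Cauchy-Schwarz inequality with summable weights \<open>w\<^sub>j \<ge> \<parallel>d\<^sub>j\<parallel>\<close> along the path and Doob's
  inequality conditionally on \<open>F\<^sub>0\<close> give a multiple of \<open>W\<^sub>J \<Sum>\<^sub>l\<^sub>\<le>\<^sub>n E\<^sub>0(g\<^sub>J \<circ> T\<^sup>l)\<close>, where \<open>W\<^sub>J = \<Sum>\<^sub>j\<^sub>\<ge>\<^sub>J w\<^sub>j\<close> and the function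
  \<open>g\<^sub>J = \<Sum>\<^sub>j\<^sub>\<ge>\<^sub>J d\<^sub>j\<^sup>2 / w\<^sub>j\<close> has mean at most \<open>W\<^sub>J\<close>.

  Altogether the conditional error divided by \<open>n\<close> is at most \<open>U / n + \<psi> + n\<^sup>-\<^sup>1 \<Sum>\<^sub>l\<^sub>\<le>\<^sub>n E\<^sub>0(\<phi> \<circ> T\<^sup>l)\<close>, with nonnegative
  \<open>\<psi>\<close> and \<open>\<phi>\<close> of arbitrarily small mean (lemma \<open>max_error_cond_exp_bound\<close>). This implies convergence in
  mean. It also implies almost sure convergence, because \<open>f \<mapsto> E\<^sub>0(f \<circ> T)\<close> acts as a positive contraction of
  \<open>L\<^sup>1\<close> and obeys the maximal ergodic inequality: the supremum over \<open>n\<close> of the averages of a function of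
  small mean is small in probability (lemmas \<open>maximal_ergodic\<close> and \<open>tendsto_zero_if_averages_bound\<close>).

  Finally \<open>D\<close> is unique: the martingales of two admissible choices \<open>D\<close> and \<open>D'\<close> differ by \<open>o(\<surd>n)\<close> in \<open>L\<^sup>2\<close>,
  whereas the square of the norm of the difference is \<open>n \<parallel>D - D'\<parallel>\<^sup>2\<close>.
\<close>

section \<open>Square integrable functions\<close>

lemma in_L2_D [dest]:
  assumes "in_L2 M f"
  shows "f \<in> borel_measurable M" "integrable M (\<lambda>x. (f x)\<^sup>2)"
  using assms by (auto simp: in_L2_def)

lemma integrable_mult_L2:
  assumes "in_L2 M f" "in_L2 M g"
  shows "integrable M (\<lambda>x. f x * g x)"
proof (rule Bochner_Integration.integrable_bound)
  show "integrable M (\<lambda>x. (f x)\<^sup>2 + (g x)\<^sup>2)"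
    using assms by (auto simp: in_L2_def)
  show "(\<lambda>x. f x * g x) \<in> borel_measurable M"
    using assms by (auto simp: in_L2_def)
  have "\<bar>u * v\<bar> \<le> u\<^sup>2 + v\<^sup>2" for u v :: real
    using sum_squares_bound[of "\<bar>u\<bar>" "\<bar>v\<bar>"] mult_nonneg_nonneg[OF abs_ge_zero[of u] abs_ge_zero[of v]]
    unfolding abs_mult power2_abs mult.assoc by linarith
  then show "AE x in M. norm (f x * g x) \<le> norm ((f x)\<^sup>2 + (g x)\<^sup>2)"
    by simp
qed

lemma in_L2_bound:
  assumes "in_L2 M g" "f \<in> borel_measurable M" "AE x in M. \<bar>f x\<bar> \<le> \<bar>g x\<bar>"
  shows "in_L2 M f"
proof -
  have [measurable]: "f \<in> borel_measurable M" by fact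
  have "integrable M (\<lambda>x. (f x)\<^sup>2)"
  proof (rule Bochner_Integration.integrable_bound[OF in_L2_D(2)[OF assms(1)]])
    show "AE x in M. norm ((f x)\<^sup>2) \<le> norm ((g x)\<^sup>2)"
      using assms(3) by eventually_elim (simp add: abs_le_square_iff)
  qed measurable
  then show ?thesis by (simp add: in_L2_def)
qed

lemma in_L2_add:
  assumes "in_L2 M f" "in_L2 M g"
  shows "in_L2 M (\<lambda>x. f x + g x)"
proof -
  have "integrable M (\<lambda>x. (f x)\<^sup>2 + (g x)\<^sup>2 + 2 * (f x * g x))"
    using assms integrable_mult_L2[OF assms] by (auto simp: in_L2_def)
  moreover have "(\<lambda>x. (f x)\<^sup>2 + (g x)\<^sup>2 + 2 * (f x * g x)) = (\<lambda>x. (f x + g x)\<^sup>2)"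
    by (auto simp: power2_eq_square algebra_simps)
  ultimately show ?thesis using assms by (auto simp: in_L2_def)
qed

lemma in_L2_cmult: "in_L2 M f \<Longrightarrow> in_L2 M (\<lambda>x. c * f x)"
  by (auto simp: in_L2_def power_mult_distrib)

lemma in_L2_diff:
  assumes "in_L2 M f" "in_L2 M g"
  shows "in_L2 M (\<lambda>x. f x - g x)"
  using in_L2_add[OF assms(1) in_L2_cmult[OF assms(2), of "-1"]] by simp

lemma in_L2_abs: "in_L2 M f \<Longrightarrow> in_L2 M (\<lambda>x. \<bar>f x\<bar>)"
  by (auto simp: in_L2_def)

lemma in_L2_sum:
  assumes "\<And>i. i \<in> I \<Longrightarrow> in_L2 M (f i)"
  shows "in_L2 M (\<lambda>x. \<Sum>i\<in>I. f i x)"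
  using assms
proof (induction I rule: infinite_finite_induct)
  case (insert i I)
  then show ?case by (simp add: in_L2_add)
qed (auto simp: in_L2_def)

lemma in_L2_Max_abs:
  assumes "finite I" "I \<noteq> {}" "\<And>i. i \<in> I \<Longrightarrow> in_L2 M (f i)"
  shows "in_L2 M (\<lambda>x. MAX i\<in>I. \<bar>f i x\<bar>)"
proof (rule in_L2_bound)
  show "in_L2 M (\<lambda>x. \<Sum>i\<in>I. \<bar>f i x\<bar>)"
    using assms by (intro in_L2_sum in_L2_abs)
  show "(\<lambda>x. MAX i\<in>I. \<bar>f i x\<bar>) \<in> borel_measurable M"
    using assms by (intro borel_measurable_Max borel_measurable_abs in_L2_D(1))
  have "\<bar>MAX i\<in>I. \<bar>f i x\<bar>\<bar> \<le> (\<Sum>i\<in>I. \<bar>f i x\<bar>)" for x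
  proof -
    obtain i where "i \<in> I" "(MAX i\<in>I. \<bar>f i x\<bar>) = \<bar>f i x\<bar>"
      using obtains_MAX[of I "\<lambda>i. \<bar>f i x\<bar>"] assms(1,2) by blast
    then show ?thesis using assms(1) member_le_sum[of i I "\<lambda>i. \<bar>f i x\<bar>"] by simp
  qed
  then show "AE x in M. \<bar>MAX i\<in>I. \<bar>f i x\<bar>\<bar> \<le> \<bar>\<Sum>i\<in>I. \<bar>f i x\<bar>\<bar>"
    by (intro AE_I2) (meson abs_ge_self order_trans)
qed

lemma (in finite_measure) integrable_L2:
  assumes "in_L2 M f"
  shows "integrable M f"
  using integrable_mult_L2[OF assms, of "\<lambda>_. 1"] by (simp add: in_L2_def)

lemma Max_power2_eq_power2_Max_abs:
  fixes f :: "'i \<Rightarrow> real"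
  assumes "finite I" "I \<noteq> {}"
  shows "(MAX i\<in>I. (f i)\<^sup>2) = (MAX i\<in>I. \<bar>f i\<bar>)\<^sup>2"
proof -
  have "(MAX i\<in>I. (f i)\<^sup>2) = Max ((\<lambda>y. (max 0 y)\<^sup>2) ` (\<lambda>i. \<bar>f i\<bar>) ` I)"
    by (simp add: image_image)
  also have "\<dots> = (\<lambda>y. (max 0 y)\<^sup>2) (MAX i\<in>I. \<bar>f i\<bar>)"
    using assms by (intro mono_Max_commute[symmetric]) (auto simp: mono_def intro!: power_mono)
  also have "\<dots> = (MAX i\<in>I. \<bar>f i\<bar>)\<^sup>2"
    using assms by (subst max_absorb2) (auto simp: Max_ge_iff)
  finally show ?thesis .
qed

section \<open>A pathwise maximal inequality\<close>

text \<open>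
  The second-moment form of Doob's maximal inequality holds path by path, up to a martingale
  transform. A deterministic inequality of this kind can be integrated under any conditional
  expectation for which the increments are centered, and this is how the conditional maximal
  inequality is obtained.
\<close>

lemma running_max_Suc:
  fixes s :: "nat \<Rightarrow> real"
  shows "(MAX i\<in>{..Suc n}. \<bar>s i\<bar>) = max (MAX i\<in>{..n}. \<bar>s i\<bar>) \<bar>s (Suc n)\<bar>"
  by (simp add: atMost_Suc max.commute)

text \<open>
  Summation by parts turns \<open>\<Sum> b\<^sub>k (\<bar>s\<^sub>k\<^sub>+\<^sub>1\<bar> - \<bar>s\<^sub>k\<bar>)\<close>, with \<open>b\<close> the running maximum of \<open>\<bar>s\<bar>\<close>, into
  \<open>b\<^sub>n \<bar>s\<^sub>n\<bar> - \<Sum> \<bar>s\<^sub>k\<^sub>+\<^sub>1\<bar> (b\<^sub>k\<^sub>+\<^sub>1 - b\<^sub>k)\<close>; the maximum moves only when it equals \<open>\<bar>s\<^sub>k\<^sub>+\<^sub>1\<bar>\<close>, and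
  \<open>b' (b' - b) \<ge> (b'\<^sup>2 - b\<^sup>2) / 2\<close>. Replacing \<open>\<bar>s\<^sub>k\<^sub>+\<^sub>1\<bar> - \<bar>s\<^sub>k\<bar>\<close> by its lower bound \<open>sgn s\<^sub>k e\<^sub>k\<^sub>+\<^sub>1\<close> makes the
  correction linear in the increments. The induction performs these three steps at once.
\<close>

lemma pathwise_Doob_aux:
  fixes s e :: "nat \<Rightarrow> real"
  assumes "s 0 = 0" "\<And>k. s (Suc k) = s k + e (Suc k)"
  shows "(MAX i\<in>{..n}. \<bar>s i\<bar>)\<^sup>2 \<le> 2 * (MAX i\<in>{..n}. \<bar>s i\<bar>) * \<bar>s n\<bar>
    - 2 * (\<Sum>k<n. (MAX i\<in>{..k}. \<bar>s i\<bar>) * sgn (s k) * e (Suc k))"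
proof (induction n)
  case 0
  then show ?case using assms by simp
next
  case (Suc n)
  define b where "b = (MAX i\<in>{..n}. \<bar>s i\<bar>)"
  define u where "u = \<bar>s (Suc n)\<bar>"
  have b0: "0 \<le> b" unfolding b_def by (auto simp: Max_ge_iff)
  have "\<bar>s n\<bar> + sgn (s n) * e (Suc n) \<le> u"
    unfolding u_def assms(2) by (auto simp: sgn_if)
  then have "b * (\<bar>s n\<bar> + sgn (s n) * e (Suc n)) \<le> b * u"
    using b0 by (rule mult_left_mono)
  then have 1: "2 * b * \<bar>s n\<bar> + 2 * (b * sgn (s n) * e (Suc n)) \<le> 2 * b * u"
    by (simp add: algebra_simps)
  have 2: "(max b u)\<^sup>2 - 2 * max b u * u \<le> b\<^sup>2 - 2 * b * u"
  proof (cases "b \<le> u")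
    case True
    have "0 \<le> (b - u)\<^sup>2" by simp
    then show ?thesis using True by (simp add: max_def power2_eq_square algebra_simps)
  qed (simp add: max_def)
  from Suc 1 2 show ?case
    unfolding running_max_Suc sum.lessThan_Suc b_def[symmetric] u_def[symmetric] by argo
qed

lemma pathwise_square:
  fixes s e :: "nat \<Rightarrow> real"
  assumes "s 0 = 0" "\<And>k. s (Suc k) = s k + e (Suc k)"
  shows "(s n)\<^sup>2 = (\<Sum>l=1..n. (e l)\<^sup>2) + (\<Sum>k<n. 2 * s k * e (Suc k))"
  by (induction n) (auto simp: assms power2_eq_square algebra_simps)

text \<open>
  The product \<open>2 b \<bar>s\<^sub>n\<bar>\<close> is split by the inequality of the means as \<open>b\<^sup>2 / 2 + 2 s\<^sub>n\<^sup>2\<close>, and \<open>s\<^sub>n\<^sup>2\<close> is expanded into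
  squares of increments plus a martingale transform.
\<close>

lemma pathwise_Doob:
  fixes s e :: "nat \<Rightarrow> real"
  assumes "s 0 = 0" "\<And>k. s (Suc k) = s k + e (Suc k)"
  shows "(MAX i\<in>{..n}. \<bar>s i\<bar>)\<^sup>2 \<le> 4 * (\<Sum>l=1..n. (e l)\<^sup>2)
    + (\<Sum>k<n. (8 * s k - 4 * ((MAX i\<in>{..k}. \<bar>s i\<bar>) * sgn (s k))) * e (Suc k))"
proof -
  define b where "b = (MAX i\<in>{..n}. \<bar>s i\<bar>)"
  define C where "C = (\<Sum>k<n. (MAX i\<in>{..k}. \<bar>s i\<bar>) * sgn (s k) * e (Suc k))"
  have "b\<^sup>2 \<le> 2 * b * \<bar>s n\<bar> - 2 * C"
    using pathwise_Doob_aux[OF assms] unfolding b_def C_def .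
  moreover have "0 \<le> (b - 2 * \<bar>s n\<bar>)\<^sup>2" by simp
  then have "4 * b * \<bar>s n\<bar> \<le> b\<^sup>2 + 4 * (s n)\<^sup>2"
    by (simp add: power2_eq_square algebra_simps)
  ultimately have "b\<^sup>2 \<le> 4 * (s n)\<^sup>2 - 4 * C" by simp
  also have "\<dots> = 4 * (\<Sum>l=1..n. (e l)\<^sup>2)
    + (\<Sum>k<n. (8 * s k - 4 * ((MAX i\<in>{..k}. \<bar>s i\<bar>) * sgn (s k))) * e (Suc k))"
    unfolding pathwise_square[OF assms] C_def
    by (simp add: sum_distrib_left sum.distrib sum_subtractf algebra_simps)
  finally show ?thesis unfolding b_def .
qed

section \<open>Conditional expectations along a measure-preserving transformation\<close>

lemma distr_funpow_eq:
  assumes "T \<in> M \<rightarrow>\<^sub>M M" "distr M M T = M"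
  shows "distr M M (T ^^ n) = M"
proof (induction n)
  case 0
  show ?case by (simp add: id_def distr_id)
next
  case (Suc n)
  have "distr M M (T ^^ Suc n) = distr (distr M M (T ^^ n)) M T"
    using assms by (subst distr_distr) (auto intro!: measurable_compose_n)
  then show ?case using Suc assms by (simp only:)
qed

lemma AE_compose:
  assumes "S \<in> M \<rightarrow>\<^sub>M M" "distr M M S = M" "AE x in M. P x"
  shows "AE x in M. P (S x)"
  by (rule AE_distrD[OF assms(1)], subst assms(2), rule assms(3))

lemma integrable_compose:
  fixes f :: "'a \<Rightarrow> real"
  assumes "S \<in> M \<rightarrow>\<^sub>M M" "distr M M S = M" "integrable M f"
  shows "integrable M (\<lambda>x. f (S x))"
  using integrable_distr[OF assms(1), of f] assms by simp

lemma integral_compose: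
  fixes f :: "'a \<Rightarrow> real"
  assumes "S \<in> M \<rightarrow>\<^sub>M M" "distr M M S = M" "f \<in> borel_measurable M"
  shows "(\<integral>x. f (S x) \<partial>M) = (\<integral>x. f x \<partial>M)"
  using integral_distr[OF assms(1), of f] assms by simp

lemma subalgebra_vimage_algebra:
  assumes "subalgebra M G" "S \<in> M \<rightarrow>\<^sub>M M"
  shows "subalgebra M (vimage_algebra (space M) S G)"
  unfolding subalgebra_def
proof
  have "space G = space M" "sets G \<subseteq> sets M" using assms by (auto simp: subalgebra_def)
  then show "sets (vimage_algebra (space M) S G) \<subseteq> sets M"
    using assms(2) measurable_space[OF assms(2)]
    by (subst sets_vimage_algebra2) (auto simp: measurable_sets)
qed simp

text \<open>
  Every set of \<open>S\<^sup>-\<^sup>1(G)\<close> is the preimage of a set of \<open>G\<close>, so the defining integrals of the two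
  sides agree by the invariance of the measure.
\<close>

lemma (in prob_space) cond_exp_compose:
  assumes G: "subalgebra M G" and S: "S \<in> M \<rightarrow>\<^sub>M M" "distr M M S = M"
    and f: "integrable M f"
  shows "AE x in M. real_cond_exp M (vimage_algebra (space M) S G) (\<lambda>x. f (S x)) x
    = real_cond_exp M G f (S x)"
proof -
  let ?V = "vimage_algebra (space M) S G"
  note V = subalgebra_vimage_algebra[OF G S(1)]
  interpret V: finite_measure_subalgebra M ?V by unfold_locales (rule V)
  interpret G: finite_measure_subalgebra M G by unfold_locales (rule G)
  have spG: "space G = space M" using G by (simp add: subalgebra_def)
  have SG: "S \<in> space M \<rightarrow> space G" using measurable_space[OF S(1)] spG by auto
  have int: "integrable M (real_cond_exp M G f)" by (rule G.real_cond_exp_int(1)[OF f])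
  show ?thesis
  proof (rule V.real_cond_exp_charact)
    show "integrable M (\<lambda>x. f (S x))" by (rule integrable_compose[OF S f])
    show "integrable M (\<lambda>x. real_cond_exp M G f (S x))" by (rule integrable_compose[OF S int])
    show "(\<lambda>x. real_cond_exp M G f (S x)) \<in> borel_measurable ?V"
      by (rule measurable_compose[OF measurable_vimage_algebra1[OF SG]]) simp
    fix A assume "A \<in> sets ?V"
    then obtain B where B: "B \<in> sets G" and A: "A = S -` B \<inter> space M"
      using sets_vimage_algebra2[OF SG] by auto
    have BM [measurable]: "B \<in> sets M" using B G by (auto simp: subalgebra_def)
    have *: "(LINT x:A|M. h (S x)) = (LINT x:B|M. h x)" if "integrable M h" for h :: "'a \<Rightarrow> real"
    proof -
      have "(LINT x:A|M. h (S x)) = (\<integral>x. (indicator B (S x) * h (S x)) \<partial>M)"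
        unfolding set_lebesgue_integral_def A
        by (intro Bochner_Integration.integral_cong) (auto simp: indicator_def)
      also have "\<dots> = (LINT x:B|M. h x)"
        unfolding set_lebesgue_integral_def
        using that by (subst integral_compose[OF S]) auto
      finally show ?thesis .
    qed
    have "(LINT x:A|M. f (S x)) = (LINT x:B|M. f x)" by (rule *[OF f])
    also have "\<dots> = (LINT x:B|M. real_cond_exp M G f x)"
      by (rule G.real_cond_exp_intA[OF f B])
    also have "\<dots> = (LINT x:A|M. real_cond_exp M G f (S x))" by (rule *[OF int, symmetric])
    finally show "(LINT x:A|M. f (S x)) = (LINT x:A|M. real_cond_exp M G f (S x))" .
  qed
qed

lemma (in finite_measure_subalgebra) in_L2_cond_exp:
  assumes "in_L2 M f"
  shows "in_L2 M (real_cond_exp M F f)"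
proof -
  have "convex_on UNIV (\<lambda>x::real. x\<^sup>2)" by (rule convex_power2)
  from integrable_convex_cond_exp[OF integrable_L2[OF assms], of UNIV, OF _ _ _ this] assms
  show ?thesis by (auto simp: in_L2_def)
qed

text \<open>
  Only the forward iterates of \<open>T\<close> and the algebras \<open>T\<^sup>-\<^sup>k(F0)\<close> with \<open>k \<ge> 0\<close> enter the
  maximal inequalities; the inverse of \<open>T\<close> is needed to define \<open>P\<^sub>0\<close> and appears later.
\<close>

locale filtered_mpt = prob_space M + finite_measure_subalgebra M F0
  for M F0 :: "'a measure" +
  fixes T :: "'a \<Rightarrow> 'a"
  assumes T [measurable]: "T \<in> M \<rightarrow>\<^sub>M M"
    and distr_T: "distr M M T = M"
    and increasing: "sets F0 \<subseteq> sets (vimage_algebra (space M) T F0)"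
begin

\<comment> \<open>Powers of \<open>T\<close> stay folded, as the facts below are stated for \<open>T ^^ k\<close>.\<close>
declare funpow.simps(2) [simp del]

abbreviation E0 :: "('a \<Rightarrow> real) \<Rightarrow> 'a \<Rightarrow> real" where
  "E0 \<equiv> real_cond_exp M F0"

abbreviation Fil :: "nat \<Rightarrow> 'a measure" where
  "Fil k \<equiv> vimage_algebra (space M) (T ^^ k) F0"

lemma T_pow [measurable]: "T ^^ n \<in> M \<rightarrow>\<^sub>M M"
  by (rule measurable_compose_n) simp

lemmas distr_T_pow = distr_funpow_eq[OF T distr_T]
lemmas AE_T_pow = AE_compose[OF T_pow distr_T_pow]
lemmas integrable_T_pow = integrable_compose[OF T_pow distr_T_pow]
lemmas integral_T_pow = integral_compose[OF T_pow distr_T_pow]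

lemma space_F0: "space F0 = space M"
  using subalg by (simp add: subalgebra_def)

lemma measurable_F0_M: "f \<in> borel_measurable F0 \<Longrightarrow> f \<in> borel_measurable M"
  for f :: "'a \<Rightarrow> real"
  by (rule measurable_from_subalg[OF subalg])

lemma T_pow_space: "T ^^ n \<in> space M \<rightarrow> space F0"
  using measurable_space[OF T_pow] space_F0 by auto

lemma in_L2_T_pow:
  assumes "in_L2 M f"
  shows "in_L2 M (\<lambda>x. f ((T ^^ n) x))"
  using assms integrable_T_pow[of "\<lambda>x. (f x)\<^sup>2" n] measurable_compose[OF T_pow, of f borel n]
  by (auto simp: in_L2_def)

lemma subalgebra_Fil: "subalgebra M (Fil k)"
  by (rule subalgebra_vimage_algebra[OF subalg T_pow])

lemma sets_Fil: "sets (Fil k) = {(T ^^ k) -` A \<inter> space M | A. A \<in> sets F0}"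
  by (rule sets_vimage_algebra2[OF T_pow_space])

lemma subalgebra_Fil_Suc: "subalgebra (Fil (Suc k)) (Fil k)"
  unfolding subalgebra_def
proof safe
  fix A assume "A \<in> sets (Fil k)"
  then obtain B where B: "B \<in> sets F0" "A = (T ^^ k) -` B \<inter> space M" by (auto simp: sets_Fil)
  then obtain C where C: "C \<in> sets F0" "B = T -` C \<inter> space M"
    using increasing sets_vimage_algebra2[of T "space M" F0] T_pow_space[of 1]
    by (auto simp: funpow.simps(2))
  have "A = (T ^^ Suc k) -` C \<inter> space M"
    unfolding B C funpow.simps(2) using measurable_space[OF T_pow] by auto
  then show "A \<in> sets (Fil (Suc k))" using C(1) by (auto simp: sets_Fil)
qed auto

lemma subalgebra_Fil_mono: "k \<le> l \<Longrightarrow> subalgebra (Fil l) (Fil k)"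
proof (induction l rule: dec_induct)
  case base
  show ?case by (simp add: subalgebra_def)
next
  case (step l)
  then show ?case using subalgebra_Fil_Suc[of l] by (auto simp: subalgebra_def)
qed

lemma sets_Fil_0: "sets (Fil 0) = sets F0"
proof -
  have "A \<inter> space M = A" if "A \<in> sets F0" for A
    using sets.sets_into_space[OF that] space_F0 by auto
  then show ?thesis unfolding sets_Fil by (auto simp: id_def) 
qed

lemma subalgebra_Fil_F0: "subalgebra (Fil k) F0"
  using subalgebra_Fil_mono[of 0 k] sets_Fil_0 space_F0 by (simp add: subalgebra_def)

lemma measurable_T_pow_Fil:
  fixes f :: "'a \<Rightarrow> real"
  assumes "f \<in> borel_measurable F0" "l \<le> k"
  shows "(\<lambda>x. f ((T ^^ l) x)) \<in> borel_measurable (Fil k)"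
  by (rule measurable_from_subalg[OF subalgebra_Fil_mono[OF assms(2)]],
    rule measurable_compose[OF measurable_vimage_algebra1[OF T_pow_space] assms(1)])

lemma cond_exp_T_pow:
  assumes "integrable M f"
  shows "AE x in M. real_cond_exp M (Fil k) (\<lambda>x. f ((T ^^ k) x)) x = E0 f ((T ^^ k) x)"
  by (rule cond_exp_compose[OF subalg T_pow distr_T_pow assms])

lemma cond_exp_Fil_nested:
  assumes "integrable M f"
  shows "AE x in M. E0 (real_cond_exp M (Fil k) f) x = E0 f x"
  by (rule real_cond_exp_nested_subalg[OF subalgebra_Fil subalgebra_Fil_F0 assms])

text \<open>
  The Markov property of \<open>Q f = E0 (f \<circ> T)\<close>: by the tower property along \<open>F0 \<subseteq> T\<^sup>-\<^sup>1(F0)\<close>, one has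
  \<open>Q (E0 (f \<circ> T\<^sup>l)) = E0 (f \<circ> T\<^sup>l\<^sup>+\<^sup>1)\<close>. Hence the functions \<open>E0 (f \<circ> T\<^sup>l)\<close> form an orbit of a positive
  contraction of \<open>L\<^sup>1\<close>.
\<close>

lemma cond_exp_cond_exp_T:
  assumes f: "integrable M f"
  shows "AE x in M. E0 (\<lambda>x. E0 f (T x)) x = E0 (\<lambda>x. f (T x)) x"
proof -
  have 1: "AE x in M. E0 (real_cond_exp M (Fil 1) (\<lambda>x. f ((T ^^ 1) x))) x = E0 (\<lambda>x. E0 f ((T ^^ 1) x)) x"
    by (intro real_cond_exp_cong cond_exp_T_pow f) auto
  have 2: "AE x in M. E0 (real_cond_exp M (Fil 1) (\<lambda>x. f ((T ^^ 1) x))) x = E0 (\<lambda>x. f ((T ^^ 1) x)) x"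
    by (intro cond_exp_Fil_nested integrable_T_pow f)
  from 1 2 show ?thesis by eventually_elim (simp add: funpow.simps(2))
qed

section \<open>The maximal ergodic inequality\<close>

text \<open>
  Hopf's maximal inequality for \<open>Q\<close>, by Garsia's argument. Let \<open>R\<^sub>k\<close> be the sums
  \<open>\<Sum>\<^sub>l\<^sub>\<le>\<^sub>k (E0 (f \<circ> T\<^sup>l) - lam)\<close> and \<open>m\<close> their maximum over \<open>0 \<le> k \<le> n\<close>. By positivity
  \<open>Q m \<ge> Q R\<^sub>k = R\<^sub>k\<^sub>+\<^sub>1 - R\<^sub>1\<close>, so \<open>m - Q m \<le> R\<^sub>1\<close> where \<open>m > 0\<close>, and \<open>m - Q m \<le> 0\<close> elsewhere. As \<open>Q\<close> preserves
  integrals, \<open>R\<^sub>1\<close> has a nonnegative integral over \<open>{m > 0}\<close>.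
\<close>

lemma maximal_ergodic_finite:
  assumes f: "integrable M f" "AE x in M. 0 \<le> f x" and lam: "0 < lam"
  shows "lam * prob {x \<in> space M. \<exists>k\<in>{1..n}. lam * real k < (\<Sum>l=1..k. E0 (\<lambda>x. f ((T ^^ l) x)) x)}
    \<le> (\<integral>x. f x \<partial>M)"
proof -
  define q where "q l = E0 (\<lambda>x. f ((T ^^ l) x))" for l
  define R where "R k x = (\<Sum>l=1..k. q l x - lam)" for k x
  define m where "m x = (MAX k\<in>{..n}. R k x)" for x
  define A where "A = {x \<in> space M. 0 < m x}"
  have q_meas [measurable]: "q l \<in> borel_measurable M" for l unfolding q_def by simp
  have intq: "integrable M (q l)" for l
    unfolding q_def by (intro real_cond_exp_int(1) integrable_T_pow f)
  have intR: "integrable M (R k)" for k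
    unfolding R_def by (intro Bochner_Integration.integrable_sum Bochner_Integration.integrable_diff intq) simp
  have R_meas [measurable]: "R k \<in> borel_measurable M" for k
    using intR[of k] by simp
  have m_meas [measurable]: "m \<in> borel_measurable M"
    unfolding m_def by (intro borel_measurable_Max) auto
  have m_nonneg: "0 \<le> m x" for x
    unfolding m_def by (subst Max_ge_iff) (auto simp: R_def intro!: bexI[of _ 0])
  have intm: "integrable M m"
  proof (rule Bochner_Integration.integrable_bound)
    show "integrable M (\<lambda>x. \<Sum>k\<le>n. \<bar>R k x\<bar>)" using intR by simp
    have "m x \<le> (\<Sum>k\<le>n. \<bar>R k x\<bar>)" for x
      unfolding m_def
      using member_le_sum[of _ "{..n}" "\<lambda>k. \<bar>R k x\<bar>"]
      by (subst Max_le_iff) (auto intro: order_trans[OF abs_ge_self])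
    then show "AE x in M. norm (m x) \<le> norm (\<Sum>k\<le>n. \<bar>R k x\<bar>)"
      using m_nonneg by (intro AE_I2) (simp add: sum_nonneg)
  qed simp
  have intmT: "integrable M (\<lambda>x. m (T x))"
    by (rule integrable_compose[OF T distr_T intm])
  have A_meas [measurable]: "A \<in> sets M" unfolding A_def by simp
  have shift: "AE x in M. E0 (\<lambda>x. R k (T x)) x = R (Suc k) x - (q 1 x - lam)" for k
  proof -
    have *: "AE x in M. E0 (\<lambda>x. q l (T x)) x = q (Suc l) x" for l
      using cond_exp_cond_exp_T[OF integrable_T_pow[OF f(1), of l]]
      unfolding q_def funpow_Suc_right comp_def .
    have intqT: "integrable M (\<lambda>x. q l (T x))" for l
      by (rule integrable_compose[OF T distr_T intq])
    have "AE x in M. E0 (\<lambda>x. \<Sum>l=1..k. q l (T x) - lam) x = (\<Sum>l=1..k. E0 (\<lambda>x. q l (T x) - lam) x)"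
      by (intro real_cond_exp_sum Bochner_Integration.integrable_diff intqT) simp
    moreover have "AE x in M. \<forall>l. E0 (\<lambda>x. q l (T x) - lam) x = E0 (\<lambda>x. q l (T x)) x - E0 (\<lambda>_. lam) x"
      unfolding AE_all_countable
      by (intro allI real_cond_exp_diff intqT) simp
    moreover have "AE x in M. E0 (\<lambda>_. lam) x = lam" by (intro real_cond_exp_F_meas) auto
    moreover have "AE x in M. \<forall>l. E0 (\<lambda>x. q l (T x)) x = q (Suc l) x"
      unfolding AE_all_countable using * by blast
    ultimately show ?thesis
    proof eventually_elim
      case (elim x)
      then have "E0 (\<lambda>x. R k (T x)) x = (\<Sum>l=1..k. q (Suc l) x - lam)"
        unfolding R_def by simp
      also have "\<dots> = (\<Sum>l=Suc 1..Suc k. q l x - lam)"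
        by (simp only: sum.atLeast_Suc_atMost_Suc_shift o_def)
      also have "\<dots> = R (Suc k) x - (q 1 x - lam)"
        unfolding R_def by (subst (2) sum.atLeast_Suc_atMost) auto
      finally show ?case .
    qed
  qed
  have "AE x in M. E0 (\<lambda>x. R k (T x)) x \<le> E0 (\<lambda>x. m (T x)) x" if "k \<le> n" for k
    using that
    by (intro real_cond_exp_mono integrable_compose[OF T distr_T intR] intmT) (auto simp: m_def)
  then have "AE x in M. \<forall>k\<in>{..n}. R (Suc k) x - (q 1 x - lam) \<le> E0 (\<lambda>x. m (T x)) x"
    unfolding AE_ball_countable[OF countable_finite[OF finite_atMost[of n]]]
  proof (intro ballI)
    fix k assume "k \<in> {..n}"
    with shift[of k] \<open>\<And>k. k \<le> n \<Longrightarrow> AE x in M. E0 (\<lambda>x. R k (T x)) x \<le> E0 (\<lambda>x. m (T x)) x\<close>[of k]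
    show "AE x in M. R (Suc k) x - (q 1 x - lam) \<le> E0 (\<lambda>x. m (T x)) x" by auto
  qed
  moreover have "AE x in M. 0 \<le> E0 (\<lambda>x. m (T x)) x"
    using m_nonneg intmT by (intro real_cond_exp_pos) auto
  moreover note AE_space
  ultimately have key: "AE x in M. m x - E0 (\<lambda>x. m (T x)) x \<le> indicator A x * (q 1 x - lam)"
  proof eventually_elim
    case (elim x)
    show ?case
    proof (cases "x \<in> A")
      case True
      obtain k where k: "k \<in> {..n}" "m x = R k x"
        using obtains_MAX[of "{..n}" "\<lambda>k. R k x"] unfolding m_def by blast
      have "k \<noteq> 0" using True k by (auto simp: A_def R_def intro: ccontr)
      then obtain j where "k = Suc j" by (cases k) auto
      then show ?thesis using elim(1)[rule_format, of j] k True by simp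
    next
      case False
      then have "m x \<le> 0" using elim(3) by (auto simp: A_def)
      then show ?thesis using elim(2) False by simp
    qed
  qed
  have "0 = (\<integral>x. m x - E0 (\<lambda>x. m (T x)) x \<partial>M)"
    using intm intmT real_cond_exp_int[OF intmT] integral_compose[OF T distr_T m_meas]
    by (subst Bochner_Integration.integral_diff) auto
  also have "\<dots> \<le> (\<integral>x. indicator A x * (q 1 x - lam) \<partial>M)"
  proof (rule integral_mono_AE[OF _ _ key])
    show "integrable M (\<lambda>x. m x - E0 (\<lambda>x. m (T x)) x)"
      by (intro Bochner_Integration.integrable_diff intm real_cond_exp_int(1)[OF intmT])
    have "integrable M (\<lambda>x. (q 1 x - lam) * indicator A x)"
      by (intro integrable_real_mult_indicator A_meas Bochner_Integration.integrable_diff intq) simp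
    then show "integrable M (\<lambda>x. indicator A x * (q 1 x - lam))"
      by (simp add: mult.commute)
  qed
  also have "\<dots> = (\<integral>x. indicator A x * q 1 x \<partial>M) - lam * prob A"
  proof -
    have "(\<integral>x. indicator A x * (q 1 x - lam) \<partial>M) = (\<integral>x. indicator A x * q 1 x - lam * indicator A x \<partial>M)"
      by (intro Bochner_Integration.integral_cong) (auto simp: algebra_simps)
    also have "\<dots> = (\<integral>x. indicator A x * q 1 x \<partial>M) - (\<integral>x. lam * indicator A x \<partial>M)"
      using integrable_real_mult_indicator[OF A_meas intq[of 1]]
        integrable_real_mult_indicator[OF A_meas integrable_const[of lam]]
      by (intro Bochner_Integration.integral_diff) (simp_all add: mult.commute)
    finally show ?thesis by simp
  qed
  finally have "lam * prob A \<le> (\<integral>x. indicator A x * q 1 x \<partial>M)" by simp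
  also have "\<dots> \<le> (\<integral>x. q 1 x \<partial>M)"
  proof (rule integral_mono_AE)
    have "AE x in M. 0 \<le> q 1 x"
      unfolding q_def using AE_T_pow[OF f(2), of 1] integrable_T_pow[OF f(1), of 1]
      by (intro real_cond_exp_pos) auto
    then show "AE x in M. indicator A x * q 1 x \<le> q 1 x"
      by eventually_elim (auto simp: indicator_def)
    show "integrable M (\<lambda>x. indicator A x * q 1 x)"
      using integrable_real_mult_indicator[OF A_meas intq[of 1]] by (simp add: mult.commute)
  qed (rule intq)
  also have "\<dots> = (\<integral>x. f x \<partial>M)"
    unfolding q_def using integral_T_pow[of f 1] f
    by (subst real_cond_exp_int(2)[OF integrable_T_pow[OF f(1)]]) auto
  finally have "lam * prob A \<le> (\<integral>x. f x \<partial>M)" .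
  moreover have "A = {x \<in> space M. \<exists>k\<in>{1..n}. lam * real k < (\<Sum>l=1..k. q l x)}"
  proof -
    have "0 < m x \<longleftrightarrow> (\<exists>k\<in>{1..n}. lam * real k < (\<Sum>l=1..k. q l x))" for x
    proof -
      have "0 < m x \<longleftrightarrow> (\<exists>k\<in>{..n}. 0 < R k x)"
        unfolding m_def by (subst Max_gr_iff) auto
      also have "\<dots> \<longleftrightarrow> (\<exists>k\<in>{1..n}. 0 < R k x)"
      proof -
        have "k \<noteq> 0" if "0 < R k x" for k using that by (auto simp: R_def intro: ccontr)
        then show ?thesis by (metis atLeastAtMost_iff atMost_iff less_one linorder_not_less)
      qed
      finally show ?thesis by (simp add: R_def sum_subtractf mult.commute)
    qed
    then show ?thesis by (simp add: A_def)
  qed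
  ultimately show ?thesis unfolding q_def by simp
qed

lemma maximal_ergodic:
  assumes f: "integrable M f" "AE x in M. 0 \<le> f x" and lam: "0 < lam"
  shows "lam * prob {x \<in> space M. \<exists>k\<ge>1. lam * real k < (\<Sum>l=1..k. E0 (\<lambda>x. f ((T ^^ l) x)) x)}
    \<le> (\<integral>x. f x \<partial>M)"
proof -
  define A where "A n = {x \<in> space M. \<exists>k\<in>{1..n}. lam * real k < (\<Sum>l=1..k. E0 (\<lambda>x. f ((T ^^ l) x)) x)}" for n
  have [measurable]: "A n \<in> sets M" for n unfolding A_def by measurable
  have "incseq A" unfolding A_def incseq_def by fastforce
  then have "(\<lambda>n. prob (A n)) \<longlonglongrightarrow> prob (\<Union>n. A n)"
    by (intro finite_Lim_measure_incseq) auto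
  then have "(\<lambda>n. lam * prob (A n)) \<longlonglongrightarrow> lam * prob (\<Union>n. A n)"
    by (intro tendsto_intros)
  moreover have "lam * prob (A n) \<le> (\<integral>x. f x \<partial>M)" for n
    unfolding A_def by (rule maximal_ergodic_finite[OF assms])
  ultimately have "lam * prob (\<Union>n. A n) \<le> (\<integral>x. f x \<partial>M)"
    by (intro LIMSEQ_le_const2) auto
  also have "(\<Union>n. A n) = {x \<in> space M. \<exists>k\<ge>1. lam * real k < (\<Sum>l=1..k. E0 (\<lambda>x. f ((T ^^ l) x)) x)}"
    unfolding A_def by fastforce
  finally show ?thesis .
qed

text \<open>
  Convergence in mean is immediate from the bound. For almost sure convergence the averages of
  \<open>E0 (\<phi> \<circ> T\<^sup>l)\<close> must be controlled uniformly in \<open>n\<close>: by the maximal inequality their supremum exceeds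
  \<open>lam\<close> with probability at most \<open>\<epsilon> / lam\<close>, and Markov's inequality does the same for \<open>\<psi>\<close>. Since \<open>U / n\<close>
  vanishes in the limit, the set where the upper limit exceeds \<open>3 lam\<close> has arbitrarily small
  probability.
\<close>

lemma tendsto_zero_if_averages_bound:
  assumes Z: "\<And>n. 1 \<le> n \<Longrightarrow> integrable M (Z n)" "\<And>n. 1 \<le> n \<Longrightarrow> AE x in M. 0 \<le> Z n x"
    and bound: "\<And>\<epsilon>. 0 < \<epsilon> \<Longrightarrow> \<exists>U \<psi> \<phi>. integrable M U \<and> integrable M \<psi> \<and> integrable M \<phi> \<and>
      (AE x in M. 0 \<le> \<psi> x) \<and> (AE x in M. 0 \<le> \<phi> x) \<and> (\<integral>x. \<psi> x \<partial>M) + (\<integral>x. \<phi> x \<partial>M) \<le> \<epsilon> \<and>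
      (\<forall>n\<ge>1. AE x in M. E0 (Z n) x \<le> U x + real n * \<psi> x + (\<Sum>l=1..n. E0 (\<lambda>x. \<phi> ((T ^^ l) x)) x))"
  shows "AE x in M. (\<lambda>n. 1 / real n * E0 (Z n) x) \<longlonglongrightarrow> 0"
    and "(\<lambda>n. \<integral>x. \<bar>1 / real n * E0 (Z n) x\<bar> \<partial>M) \<longlonglongrightarrow> 0"
proof -
  define L where "L n x = 1 / real n * E0 (Z n) x" for n x
  have L_meas [measurable]: "L n \<in> borel_measurable M" for n unfolding L_def by simp
  have E0Z: "AE x in M. 0 \<le> E0 (Z n) x" if "1 \<le> n" for n
    using Z[OF that] by (intro real_cond_exp_pos) auto
  have "AE x in M. 0 \<le> L n x" for n
  proof (cases "n = 0")
    case False
    then have "1 \<le> n" by simp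
    from E0Z[OF this] show ?thesis by eventually_elim (simp add: L_def)
  qed (simp add: L_def)
  then have L_nonneg: "AE x in M. \<forall>n. 0 \<le> L n x"
    unfolding AE_all_countable by blast
  have null: "AE x in M. \<exists>N. \<forall>n\<ge>N. L n x \<le> 3 * lam" if lam: "0 < lam" for lam
  proof -
    define B where "B = {x \<in> space M. \<not> (\<exists>N. \<forall>n\<ge>N. L n x \<le> 3 * lam)}"
    have [measurable]: "B \<in> sets M" unfolding B_def by measurable
    have "prob B \<le> \<epsilon> / lam" if eps: "0 < \<epsilon>" for \<epsilon>
    proof -
      obtain U \<psi> \<phi> where U: "integrable M U" and psi: "integrable M \<psi>" "AE x in M. 0 \<le> \<psi> x"
        and phi: "integrable M \<phi>" "AE x in M. 0 \<le> \<phi> x"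
        and small: "(\<integral>x. \<psi> x \<partial>M) + (\<integral>x. \<phi> x \<partial>M) \<le> \<epsilon>"
        and le: "\<And>n. n \<ge> 1 \<Longrightarrow> AE x in M. E0 (Z n) x \<le> U x + real n * \<psi> x + (\<Sum>l=1..n. E0 (\<lambda>x. \<phi> ((T ^^ l) x)) x)"
        using bound[OF eps] by blast
      define C where "C = {x \<in> space M. lam \<le> \<psi> x}"
      define C' where "C' = {x \<in> space M. \<exists>k\<ge>1. lam * real k < (\<Sum>l=1..k. E0 (\<lambda>x. \<phi> ((T ^^ l) x)) x)}"
      have [measurable]: "\<psi> \<in> borel_measurable M" using psi by simp
      have [measurable]: "C \<in> sets M" "C' \<in> sets M" unfolding C_def C'_def by measurable
      have "AE x in M. \<forall>n. n \<ge> 1 \<longrightarrow> E0 (Z n) x \<le> U x + real n * \<psi> x + (\<Sum>l=1..n. E0 (\<lambda>x. \<phi> ((T ^^ l) x)) x)"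
        unfolding AE_all_countable using le by auto
      then have "AE x in M. x \<in> B \<longrightarrow> x \<in> C \<union> C'"
        using AE_space
      proof eventually_elim
        case (elim x)
        have "\<exists>N. \<forall>n\<ge>N. L n x \<le> 3 * lam" if "x \<notin> C \<union> C'"
        proof -
          have "(\<lambda>n. \<bar>U x\<bar> / real n) \<longlonglongrightarrow> 0"
            by (rule lim_const_over_n)
          then have "eventually (\<lambda>n. \<bar>U x\<bar> / real n < lam) sequentially"
            using lam by (rule order_tendstoD)
          then obtain N where N: "\<And>n. n \<ge> N \<Longrightarrow> \<bar>U x\<bar> / real n < lam"
            by (auto simp: eventually_sequentially)
          have "L n x \<le> 3 * lam" if n: "n \<ge> max N 1" for n
          proof -
            have "E0 (Z n) x \<le> U x + real n * \<psi> x + (\<Sum>l=1..n. E0 (\<lambda>x. \<phi> ((T ^^ l) x)) x)"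
              using elim(1) n by simp
            also have "(\<Sum>l=1..n. E0 (\<lambda>x. \<phi> ((T ^^ l) x)) x) \<le> real n * lam"
              using \<open>x \<notin> C \<union> C'\<close> elim(2) n by (auto simp: C'_def not_less mult.commute)
            also have "real n * \<psi> x \<le> real n * lam"
              using \<open>x \<notin> C \<union> C'\<close> elim(2) by (intro mult_left_mono) (auto simp: C_def)
            also have "U x \<le> real n * lam"
              using N[of n] n by (simp add: field_simps)
            finally show ?thesis
              using n unfolding L_def by (simp add: field_simps)
          qed
          then show ?thesis by blast
        qed
        then show ?case by (auto simp: B_def)
      qed
      then have "prob B \<le> prob (C \<union> C')" by (intro finite_measure_mono_AE) auto
      also have "\<dots> \<le> prob C + prob C'" by (rule measure_Un_le) auto
      also have "prob C \<le> (\<integral>x. \<psi> x \<partial>M) / lam"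
        unfolding C_def using psi lam
        by (intro integral_Markov_inequality_measure[where A="{}"]) auto
      also have "prob C' \<le> (\<integral>x. \<phi> x \<partial>M) / lam"
        using maximal_ergodic[OF phi lam] lam unfolding C'_def by (simp add: field_simps)
      also have "(\<integral>x. \<psi> x \<partial>M) / lam + (\<integral>x. \<phi> x \<partial>M) / lam \<le> \<epsilon> / lam"
        using divide_right_mono[OF small, of lam] lam by (simp add: add_divide_distrib)
      finally show ?thesis by simp
    qed
    then have "prob B \<le> 0 + r" if "0 < r" for r
      using that lam by (metis add_0 mult_pos_pos nonzero_mult_div_cancel_right order_less_irrefl)
    then have "prob B = 0"
      using field_le_epsilon[of "prob B" 0] measure_nonneg[of M B] by auto
    then have "AE x in M. x \<notin> B"
      by (simp add: prob_eq_0)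
    then show ?thesis using AE_space by eventually_elim (auto simp: B_def)
  qed
  have "AE x in M. \<forall>m. \<exists>N. \<forall>n\<ge>N. L n x \<le> 3 * inverse (real (Suc m))"
    unfolding AE_all_countable by (intro allI null) simp
  with L_nonneg show "AE x in M. (\<lambda>n. 1 / real n * E0 (Z n) x) \<longlonglongrightarrow> 0"
  proof eventually_elim
    case (elim x)
    have "(\<lambda>n. L n x) \<longlonglongrightarrow> 0"
    proof (rule LIMSEQ_I)
      fix r :: real assume "0 < r"
      then obtain m where m: "inverse (real (Suc m)) < r / 3"
        using reals_Archimedean[of "r / 3"] by auto
      obtain N where "\<And>n. n \<ge> N \<Longrightarrow> L n x \<le> 3 * inverse (real (Suc m))"
        using elim(2) by blast
      then show "\<exists>N. \<forall>n\<ge>N. norm (L n x - 0) < r"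
        using m elim(1) by (intro exI[of _ N]) fastforce
    qed
    then show ?case unfolding L_def .
  qed
  show "(\<lambda>n. \<integral>x. \<bar>1 / real n * E0 (Z n) x\<bar> \<partial>M) \<longlonglongrightarrow> 0"
  proof (rule LIMSEQ_I)
    fix r :: real assume r: "0 < r"
    obtain U \<psi> \<phi> where U: "integrable M U" and psi: "integrable M \<psi>"
      and phi: "integrable M \<phi>"
      and small: "(\<integral>x. \<psi> x \<partial>M) + (\<integral>x. \<phi> x \<partial>M) \<le> r / 2"
      and le: "\<And>n. n \<ge> 1 \<Longrightarrow> AE x in M. E0 (Z n) x \<le> U x + real n * \<psi> x + (\<Sum>l=1..n. E0 (\<lambda>x. \<phi> ((T ^^ l) x)) x)"
      using bound[OF half_gt_zero[OF r]] by blast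
    have "(\<lambda>n. (\<integral>x. U x \<partial>M) / real n) \<longlonglongrightarrow> 0"
      by (rule lim_const_over_n)
    then have "eventually (\<lambda>n. (\<integral>x. U x \<partial>M) / real n < r / 2) sequentially"
      using r by (intro order_tendstoD) auto
    then obtain N where N: "\<And>n. n \<ge> N \<Longrightarrow> (\<integral>x. U x \<partial>M) / real n < r / 2"
      by (auto simp: eventually_sequentially)
    have "norm ((\<integral>x. \<bar>1 / real n * E0 (Z n) x\<bar> \<partial>M) - 0) < r" if n: "n \<ge> max N 1" for n
    proof -
      have intphi: "integrable M (\<lambda>x. \<phi> ((T ^^ l) x))" for l by (rule integrable_T_pow[OF phi])
      have "(\<integral>x. \<bar>1 / real n * E0 (Z n) x\<bar> \<partial>M) = (\<integral>x. 1 / real n * E0 (Z n) x \<partial>M)"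
        using E0Z[of n] n by (intro integral_cong_AE) (auto elim!: eventually_mono)
      also have "\<dots> = 1 / real n * (\<integral>x. E0 (Z n) x \<partial>M)" by simp
      also have "(\<integral>x. E0 (Z n) x \<partial>M)
          \<le> (\<integral>x. U x + real n * \<psi> x + (\<Sum>l=1..n. E0 (\<lambda>x. \<phi> ((T ^^ l) x)) x) \<partial>M)"
        using n by (intro integral_mono_AE le real_cond_exp_int(1) Z(1) Bochner_Integration.integrable_add
            Bochner_Integration.integrable_sum U integrable_mult_right psi intphi) auto
      also have "\<dots> = (\<integral>x. U x \<partial>M) + real n * (\<integral>x. \<psi> x \<partial>M) + (\<Sum>l=1..n. \<integral>x. E0 (\<lambda>x. \<phi> ((T ^^ l) x)) x \<partial>M)"
        using real_cond_exp_int(1)[OF intphi] U psi by simp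
      also have "(\<Sum>l=1..n. \<integral>x. E0 (\<lambda>x. \<phi> ((T ^^ l) x)) x \<partial>M) = real n * (\<integral>x. \<phi> x \<partial>M)"
        using real_cond_exp_int(2)[OF intphi] integral_T_pow[of \<phi>] phi by simp
      finally have "(\<integral>x. \<bar>1 / real n * E0 (Z n) x\<bar> \<partial>M)
          \<le> (\<integral>x. U x \<partial>M) / real n + ((\<integral>x. \<psi> x \<partial>M) + (\<integral>x. \<phi> x \<partial>M))"
        using n by (simp add: field_simps)
      also have "(\<integral>x. U x \<partial>M) / real n < r / 2" using N n by simp
      finally have "(\<integral>x. \<bar>1 / real n * E0 (Z n) x\<bar> \<partial>M) < r" using small by linarith
      then show ?thesis by simp
    qed
    then show "\<exists>N. \<forall>n\<ge>N. norm ((\<integral>x. \<bar>1 / real n * E0 (Z n) x\<bar> \<partial>M) - 0) < r"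
      by blast
  qed
qed

section \<open>Stationary martingale differences\<close>

text \<open>
  For \<open>e\<close> measurable with respect to \<open>F0\<close> and \<open>E0 (e \<circ> T) = 0\<close>, the functions \<open>e \<circ> T\<^sup>l\<close> are martingale
  differences for the increasing algebras \<open>Fil l\<close>.
\<close>

definition mart_sum :: "('a \<Rightarrow> real) \<Rightarrow> nat \<Rightarrow> 'a \<Rightarrow> real" where
  "mart_sum e k x = (\<Sum>l=1..k. e ((T ^^ l) x))"

lemma mart_sum_0 [simp]: "mart_sum e 0 x = 0"
  by (simp add: mart_sum_def)

lemma mart_sum_Suc: "mart_sum e (Suc k) x = mart_sum e k x + e ((T ^^ Suc k) x)"
  by (simp add: mart_sum_def)

lemma in_L2_mart_sum:
  "in_L2 M e \<Longrightarrow> in_L2 M (mart_sum e k)"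
  unfolding mart_sum_def[abs_def] by (intro in_L2_sum in_L2_T_pow)

lemma measurable_mart_sum:
  assumes "e \<in> borel_measurable F0" "k \<le> n"
  shows "mart_sum e k \<in> borel_measurable (Fil n)"
  unfolding mart_sum_def[abs_def] using assms by (intro borel_measurable_sum measurable_T_pow_Fil) auto

lemma cond_exp_mult_mart_diff:
  assumes e: "in_L2 M e" "AE x in M. E0 (\<lambda>x. e (T x)) x = 0"
    and H: "in_L2 M H" "H \<in> borel_measurable (Fil k)"
  shows "AE x in M. E0 (\<lambda>x. H x * e ((T ^^ Suc k) x)) x = 0"
proof -
  let ?f = "\<lambda>x. e ((T ^^ Suc k) x)"
  interpret K: finite_measure_subalgebra M "Fil k"
    by unfold_locales (rule subalgebra_Fil)
  have f: "in_L2 M ?f" by (rule in_L2_T_pow[OF e(1)])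
  have int: "integrable M (\<lambda>x. H x * ?f x)" by (rule integrable_mult_L2[OF H(1) f])
  have intT: "integrable M (\<lambda>x. e (T x))"
    by (rule integrable_compose[OF T distr_T integrable_L2[OF e(1)]])
  have "AE x in M. real_cond_exp M (Fil k) (\<lambda>x. H x * ?f x) x = H x * real_cond_exp M (Fil k) ?f x"
    by (rule K.real_cond_exp_mult[OF H(2) in_L2_D(1)[OF f] int])
  moreover have "AE x in M. real_cond_exp M (Fil k) ?f x = E0 (\<lambda>x. e (T x)) ((T ^^ k) x)"
    using cond_exp_T_pow[OF intT, of k] by (simp add: funpow.simps(2))
  moreover have "AE x in M. E0 (\<lambda>x. e (T x)) ((T ^^ k) x) = 0"
    by (rule AE_T_pow[OF e(2)])
  ultimately have "AE x in M. real_cond_exp M (Fil k) (\<lambda>x. H x * ?f x) x = 0"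
    by eventually_elim simp
  then have "AE x in M. E0 (real_cond_exp M (Fil k) (\<lambda>x. H x * ?f x)) x = E0 (\<lambda>_. 0) x"
    by (intro real_cond_exp_cong) auto
  moreover have "AE x in M. E0 (\<lambda>_. 0) x = 0" by (intro real_cond_exp_F_meas) auto
  moreover note cond_exp_Fil_nested[OF int, of k]
  ultimately show ?thesis by eventually_elim simp
qed

lemma integrable_square_T_pow:
  "in_L2 M e \<Longrightarrow> integrable M (\<lambda>x. (e ((T ^^ l) x))\<^sup>2)"
  by (rule integrable_T_pow[OF in_L2_D(2)])

text \<open>
  Conditioning on \<open>F0\<close> removes the martingale transform on the right of the pathwise
  inequalities. The constant \<open>c\<close> is \<open>4\<close> for Doob's inequality and \<open>1\<close> for the second moment.
\<close>

lemma cond_exp_mart_transform: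
  assumes e: "in_L2 M e" "AE x in M. E0 (\<lambda>x. e (T x)) x = 0"
    and H: "\<And>k. in_L2 M (H k)" "\<And>k. H k \<in> borel_measurable (Fil k)"
  shows "AE x in M. E0 (\<lambda>x. c * (\<Sum>l=1..n. (e ((T ^^ l) x))\<^sup>2) + (\<Sum>k<n. H k x * e ((T ^^ Suc k) x))) x
    = c * (\<Sum>l=1..n. E0 (\<lambda>x. (e ((T ^^ l) x))\<^sup>2) x)"
proof -
  note int = integrable_square_T_pow[OF e(1)]
  have int': "integrable M (\<lambda>x. H k x * e ((T ^^ Suc k) x))" for k
    by (rule integrable_mult_L2[OF H(1) in_L2_T_pow[OF e(1)]])
  have "AE x in M. E0 (\<lambda>x. c * (\<Sum>l=1..n. (e ((T ^^ l) x))\<^sup>2) + (\<Sum>k<n. H k x * e ((T ^^ Suc k) x))) x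
    = E0 (\<lambda>x. c * (\<Sum>l=1..n. (e ((T ^^ l) x))\<^sup>2)) x + E0 (\<lambda>x. \<Sum>k<n. H k x * e ((T ^^ Suc k) x)) x"
    by (intro real_cond_exp_add integrable_mult_right Bochner_Integration.integrable_sum int int')
  moreover have "AE x in M. E0 (\<lambda>x. c * (\<Sum>l=1..n. (e ((T ^^ l) x))\<^sup>2)) x
    = c * E0 (\<lambda>x. \<Sum>l=1..n. (e ((T ^^ l) x))\<^sup>2) x"
    by (intro real_cond_exp_cmult Bochner_Integration.integrable_sum int)
  moreover have "AE x in M. E0 (\<lambda>x. \<Sum>l=1..n. (e ((T ^^ l) x))\<^sup>2) x = (\<Sum>l=1..n. E0 (\<lambda>x. (e ((T ^^ l) x))\<^sup>2) x)"
    by (intro real_cond_exp_sum int)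
  moreover have "AE x in M. E0 (\<lambda>x. \<Sum>k<n. H k x * e ((T ^^ Suc k) x)) x
      = (\<Sum>k<n. E0 (\<lambda>x. H k x * e ((T ^^ Suc k) x)) x)"
    by (intro real_cond_exp_sum int')
  moreover have "AE x in M. \<forall>k. E0 (\<lambda>x. H k x * e ((T ^^ Suc k) x)) x = 0"
    unfolding AE_all_countable by (intro allI cond_exp_mult_mart_diff e H)
  ultimately show ?thesis by eventually_elim simp
qed

lemma conditional_Doob:
  assumes e: "e \<in> borel_measurable F0" "in_L2 M e" "AE x in M. E0 (\<lambda>x. e (T x)) x = 0"
  shows "AE x in M. E0 (\<lambda>x. (MAX k\<in>{..n}. \<bar>mart_sum e k x\<bar>)\<^sup>2) x
    \<le> 4 * (\<Sum>l=1..n. E0 (\<lambda>x. (e ((T ^^ l) x))\<^sup>2) x)"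
proof -
  define H where "H k x = 8 * mart_sum e k x - 4 * ((MAX i\<in>{..k}. \<bar>mart_sum e i x\<bar>) * sgn (mart_sum e k x))" for k x
  have max_meas: "(\<lambda>x. MAX i\<in>{..k}. \<bar>mart_sum e i x\<bar>) \<in> borel_measurable (Fil k)" for k
    using measurable_mart_sum[OF e(1), of _ k]
    by (intro borel_measurable_Max borel_measurable_abs) auto
  have H_meas: "H k \<in> borel_measurable (Fil k)" for k
    unfolding H_def[abs_def] using max_meas[of k] measurable_mart_sum[OF e(1), of k k]
    by (intro borel_measurable_diff borel_measurable_times borel_measurable_const borel_measurable_sgn) auto
  have max_L2: "in_L2 M (\<lambda>x. MAX i\<in>{..k}. \<bar>mart_sum e i x\<bar>)" for k
    by (intro in_L2_Max_abs in_L2_mart_sum e) auto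
  have H_L2: "in_L2 M (H k)" for k
    unfolding H_def[abs_def]
  proof (intro in_L2_diff in_L2_cmult in_L2_mart_sum e)
    show "in_L2 M (\<lambda>x. (MAX i\<in>{..k}. \<bar>mart_sum e i x\<bar>) * sgn (mart_sum e k x))"
    proof (rule in_L2_bound[OF max_L2[of k]])
      show "(\<lambda>x. (MAX i\<in>{..k}. \<bar>mart_sum e i x\<bar>) * sgn (mart_sum e k x)) \<in> borel_measurable M"
        using in_L2_D(1)[OF max_L2[of k]] in_L2_D(1)[OF in_L2_mart_sum[OF e(2), of k]]
        by measurable
    qed (auto simp: abs_mult sgn_if)
  qed
  note int = integrable_square_T_pow[OF e(2)]
  have int': "integrable M (\<lambda>x. H k x * e ((T ^^ Suc k) x))" for k
    by (rule integrable_mult_L2[OF H_L2 in_L2_T_pow[OF e(2)]])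
  have "AE x in M. E0 (\<lambda>x. (MAX k\<in>{..n}. \<bar>mart_sum e k x\<bar>)\<^sup>2) x
    \<le> E0 (\<lambda>x. 4 * (\<Sum>l=1..n. (e ((T ^^ l) x))\<^sup>2) + (\<Sum>k<n. H k x * e ((T ^^ Suc k) x))) x"
  proof (rule real_cond_exp_mono)
    show "AE x in M. (MAX k\<in>{..n}. \<bar>mart_sum e k x\<bar>)\<^sup>2
      \<le> 4 * (\<Sum>l=1..n. (e ((T ^^ l) x))\<^sup>2) + (\<Sum>k<n. H k x * e ((T ^^ Suc k) x))"
      unfolding H_def
      by (intro AE_I2 pathwise_Doob[where s="\<lambda>k. mart_sum e k _" and e="\<lambda>l. e ((T ^^ l) _)"])
        (simp_all add: mart_sum_Suc)
    show "integrable M (\<lambda>x. (MAX k\<in>{..n}. \<bar>mart_sum e k x\<bar>)\<^sup>2)"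
      by (rule in_L2_D(2)[OF max_L2])
  qed (intro Bochner_Integration.integrable_add integrable_mult_right Bochner_Integration.integrable_sum int int')
  moreover note cond_exp_mart_transform[OF e(2,3) H_L2 H_meas, of 4 n]
  ultimately show ?thesis by eventually_elim simp
qed

lemma mart_sum_second_moment:
  assumes e: "e \<in> borel_measurable F0" "in_L2 M e" "AE x in M. E0 (\<lambda>x. e (T x)) x = 0"
  shows "(\<integral>x. (mart_sum e n x)\<^sup>2 \<partial>M) = real n * (\<integral>x. (e x)\<^sup>2 \<partial>M)"
proof -
  have H_L2: "in_L2 M (\<lambda>x. 2 * mart_sum e k x)" for k
    by (intro in_L2_cmult in_L2_mart_sum e)
  have H_meas: "(\<lambda>x. 2 * mart_sum e k x) \<in> borel_measurable (Fil k)" for k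
    using measurable_mart_sum[OF e(1), of k k] by simp
  have eq: "(mart_sum e n x)\<^sup>2 = 1 * (\<Sum>l=1..n. (e ((T ^^ l) x))\<^sup>2) + (\<Sum>k<n. 2 * mart_sum e k x * e ((T ^^ Suc k) x))" for x
    using pathwise_square[where s="\<lambda>k. mart_sum e k x" and e="\<lambda>l. e ((T ^^ l) x)"]
    by (simp add: mart_sum_Suc)
  note int = integrable_square_T_pow[OF e(2)]
  have "(\<integral>x. (mart_sum e n x)\<^sup>2 \<partial>M) = (\<integral>x. E0 (\<lambda>x. (mart_sum e n x)\<^sup>2) x \<partial>M)"
    by (rule real_cond_exp_int(2)[symmetric]) (rule in_L2_D(2)[OF in_L2_mart_sum[OF e(2)]])
  also have "\<dots> = (\<integral>x. 1 * (\<Sum>l=1..n. E0 (\<lambda>x. (e ((T ^^ l) x))\<^sup>2) x) \<partial>M)"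
    using cond_exp_mart_transform[OF e(2,3) H_L2 H_meas, of 1 n]
    unfolding eq by (intro integral_cong_AE) auto
  also have "\<dots> = (\<Sum>l=1..n. \<integral>x. E0 (\<lambda>x. (e ((T ^^ l) x))\<^sup>2) x \<partial>M)"
    using real_cond_exp_int(1)[OF int] by simp
  also have "\<dots> = real n * (\<integral>x. (e x)\<^sup>2 \<partial>M)"
    using real_cond_exp_int(2)[OF int] integral_T_pow[of "\<lambda>x. (e x)\<^sup>2"] in_L2_D[OF e(2)] by simp
  finally show ?thesis .
qed

end

section \<open>Convergence of series in mean\<close>

lemma AE_summable_if_summable_integral:
  fixes f :: "nat \<Rightarrow> 'a \<Rightarrow> real"
  assumes f: "\<And>i. integrable M (f i)" "\<And>i x. 0 \<le> f i x" and sum: "summable (\<lambda>i. \<integral>x. f i x \<partial>M)"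
  shows "AE x in M. summable (\<lambda>i. f i x)"
proof -
  have [measurable]: "f i \<in> borel_measurable M" for i using f(1)[of i] by simp
  have "(\<integral>\<^sup>+x. (\<Sum>i. ennreal (f i x)) \<partial>M) = (\<Sum>i. \<integral>\<^sup>+x. ennreal (f i x) \<partial>M)"
    by (intro nn_integral_suminf) auto
  also have "\<dots> = (\<Sum>i. ennreal (\<integral>x. f i x \<partial>M))"
    using f by (intro suminf_cong nn_integral_eq_integral) auto
  also have "\<dots> = ennreal (\<Sum>i. \<integral>x. f i x \<partial>M)"
    using f sum by (intro suminf_ennreal2) auto
  finally have "AE x in M. (\<Sum>i. ennreal (f i x)) \<noteq> \<infinity>"
    by (intro nn_integral_PInf_AE) auto
  then show ?thesis
    by eventually_elim (auto intro!: summable_suminf_not_top f)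
qed

lemma
  fixes f :: "nat \<Rightarrow> 'a \<Rightarrow> real"
  assumes f: "\<And>i. integrable M (f i)" "\<And>i x. 0 \<le> f i x" and sum: "summable (\<lambda>i. \<integral>x. f i x \<partial>M)"
  shows integrable_tail_series: "integrable M (\<lambda>x. \<Sum>i. f (i + J) x)"
    and integral_tail_series: "(\<integral>x. (\<Sum>i. f (i + J) x) \<partial>M) = (\<Sum>i. \<integral>x. f (i + J) x \<partial>M)"
proof -
  have "AE x in M. summable (\<lambda>i. norm (f (i + J) x))"
    using AE_summable_if_summable_integral[OF assms]
    by eventually_elim (auto simp: f intro: summable_ignore_initial_segment)
  moreover have "summable (\<lambda>i. \<integral>x. norm (f (i + J) x) \<partial>M)"
    using summable_ignore_initial_segment[OF sum, of J] by (simp add: f)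
  ultimately show "integrable M (\<lambda>x. \<Sum>i. f (i + J) x)"
    "(\<integral>x. (\<Sum>i. f (i + J) x) \<partial>M) = (\<Sum>i. \<integral>x. f (i + J) x \<partial>M)"
    by (auto intro!: integrable_suminf integral_suminf f)
qed

lemma tail_series_tendsto_0:
  fixes f :: "nat \<Rightarrow> real"
  assumes "summable f"
  shows "(\<lambda>J. \<Sum>i. f (i + J)) \<longlonglongrightarrow> 0"
proof -
  have "(\<lambda>J. suminf f - (\<Sum>i<J. f i)) \<longlonglongrightarrow> suminf f - suminf f"
    by (intro tendsto_intros summable_LIMSEQ assms)
  then show ?thesis
    using suminf_minus_initial_segment[OF assms] by simp
qed

text \<open>
  With weights comparable to the norms of the summands, this inequality replaces Minkowski's:
  if \<open>c\<^sub>i\<close> has norm at most \<open>w\<^sub>i\<close>, the right-hand side has mean at most \<open>(\<Sum> w\<^sub>i)\<^sup>2\<close>, and being linear in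
  the squares \<open>c\<^sub>i\<^sup>2\<close> it is well suited to conditional expectations.
\<close>

lemma weighted_Cauchy_Schwarz:
  fixes c w :: "'i \<Rightarrow> real"
  assumes "\<And>i. i \<in> I \<Longrightarrow> 0 < w i"
  shows "(\<Sum>i\<in>I. c i)\<^sup>2 \<le> (\<Sum>i\<in>I. w i) * (\<Sum>i\<in>I. (c i)\<^sup>2 / w i)"
proof -
  have "(\<Sum>i\<in>I. c i) = (\<Sum>i\<in>I. sqrt (w i) * (c i / sqrt (w i)))"
    using assms by (intro sum.cong) force+
  also have "\<dots>\<^sup>2 \<le> (\<Sum>i\<in>I. (sqrt (w i))\<^sup>2) * (\<Sum>i\<in>I. (c i / sqrt (w i))\<^sup>2)"
    by (rule Cauchy_Schwarz_ineq_sum)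
  also have "\<dots> = (\<Sum>i\<in>I. w i) * (\<Sum>i\<in>I. (c i)\<^sup>2 / w i)"
    using assms by (intro arg_cong2[where f="(*)"] sum.cong) (auto simp: power_divide less_imp_le)
  finally show ?thesis .
qed

lemma weighted_Cauchy_Schwarz_suminf:
  fixes c w :: "nat \<Rightarrow> real"
  assumes w: "\<And>i. 0 < w i" "summable w" and c: "summable c" "summable (\<lambda>i. (c i)\<^sup>2 / w i)"
  shows "(\<Sum>i. c i)\<^sup>2 \<le> (\<Sum>i. w i) * (\<Sum>i. (c i)\<^sup>2 / w i)"
proof (rule LIMSEQ_le)
  show "(\<lambda>n. (\<Sum>i<n. c i)\<^sup>2) \<longlonglongrightarrow> (\<Sum>i. c i)\<^sup>2"
    by (intro tendsto_intros summable_LIMSEQ c)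
  show "(\<lambda>n. (\<Sum>i<n. w i) * (\<Sum>i<n. (c i)\<^sup>2 / w i)) \<longlonglongrightarrow> (\<Sum>i. w i) * (\<Sum>i. (c i)\<^sup>2 / w i)"
    by (intro tendsto_intros summable_LIMSEQ w c)
  show "\<exists>N. \<forall>n\<ge>N. (\<Sum>i<n. c i)\<^sup>2 \<le> (\<Sum>i<n. w i) * (\<Sum>i<n. (c i)\<^sup>2 / w i)"
    using weighted_Cauchy_Schwarz[of _ w c] w(1) by blast
qed

section \<open>A deterministic bound on the approximation error\<close>

text \<open>
  Read \<open>\<delta> j l\<close> as \<open>d\<^sub>j \<circ> T\<^sup>l\<close> along a fixed orbit. The double sum in \<open>X\<^sub>1 + \<dots> + X\<^sub>k\<close> contains \<open>\<delta> j l\<close> exactly for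
  \<open>1 \<le> l \<le> k - j\<close>, so that it equals \<open>\<Sum>\<^sub>j N j (k - j)\<close>; the truncated subtraction gives \<open>0\<close> for \<open>j \<ge> k\<close>, as
  it should. The sum of the \<open>D\<^sub>l\<close> is \<open>\<Sum>\<^sub>j N j k\<close>.
\<close>

lemma pathwise_decomposition:
  fixes \<delta> :: "nat \<Rightarrow> nat \<Rightarrow> real" and X a D :: "nat \<Rightarrow> real"
  defines "N \<equiv> \<lambda>j k. \<Sum>l=1..k. \<delta> j l"
  assumes X: "\<And>i. 1 \<le> i \<Longrightarrow> i \<le> k \<Longrightarrow> X i = a i + (\<Sum>l=1..i. \<delta> (i - l) l)"
    and D: "\<And>l. 1 \<le> l \<Longrightarrow> l \<le> k \<Longrightarrow> D l = (\<Sum>j\<le>p. \<delta> j l)"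
    and k: "k \<le> p"
  shows "(\<Sum>i=1..k. X i - D i) = (\<Sum>i=1..k. a i) - (\<Sum>j\<le>p. N j k - N j (k - j))"
  using X D k
proof (induction k)
  case 0
  then show ?case by (simp add: N_def)
next
  case (Suc k)
  have N_Suc: "N j (Suc k) = N j k + \<delta> j (Suc k)" for j by (simp add: N_def)
  have N_diff: "N j (Suc k - j) = N j (k - j) + (if j \<le> k then \<delta> j (Suc k - j) else 0)" for j
    by (auto simp: N_def Suc_diff_le)
  have "(\<Sum>l=1..Suc k. \<delta> (Suc k - l) l) = (\<Sum>j\<le>k. \<delta> j (Suc k - j))"
    by (rule sum.reindex_bij_witness[where i="\<lambda>j. Suc k - j" and j="\<lambda>l. Suc k - l"]) auto
  also have "\<dots> = (\<Sum>j\<le>p. if j \<le> k then \<delta> j (Suc k - j) else 0)"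
    using Suc.prems(3) by (intro sum.mono_neutral_cong_left) auto
  finally have "X (Suc k) - D (Suc k)
      = a (Suc k) + (\<Sum>j\<le>p. if j \<le> k then \<delta> j (Suc k - j) else 0) - (\<Sum>j\<le>p. \<delta> j (Suc k))"
    using Suc.prems(1)[of "Suc k"] Suc.prems(2)[of "Suc k"] by simp
  moreover have "(\<Sum>i=1..k. X i - D i) = (\<Sum>i=1..k. a i) - (\<Sum>j\<le>p. N j k - N j (k - j))"
    using Suc.prems by (intro Suc.IH) auto
  ultimately show ?case
    by (simp add: N_Suc N_diff sum.distrib sum_subtractf)
qed

text \<open>
  The number of indices in \<open>{I..n}\<close> is at most \<open>n\<close> because \<open>I \<ge> 1\<close>, which gives the factor \<open>n\<close> in the
  Cauchy-Schwarz inequality.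
\<close>

lemma early_part_bound:
  fixes a :: "nat \<Rightarrow> real"
  assumes "1 \<le> I" "k \<le> n"
  shows "(\<Sum>i=1..k. a i)\<^sup>2 \<le> 2 * (\<Sum>i<I. \<bar>a i\<bar>)\<^sup>2 + 2 * (real n * (\<Sum>i=I..n. (a i)\<^sup>2))"
proof -
  define u where "u = (\<Sum>i<I. \<bar>a i\<bar>)"
  define v where "v = (\<Sum>i=I..n. \<bar>a i\<bar>)"
  have "\<bar>\<Sum>i=1..k. a i\<bar> \<le> (\<Sum>i=1..k. \<bar>a i\<bar>)" by (rule sum_abs)
  also have "\<dots> \<le> (\<Sum>i\<in>{..<I} \<union> {I..n}. \<bar>a i\<bar>)"
    using assms by (intro sum_mono2) auto
  also have "\<dots> = u + v"
    unfolding u_def v_def by (intro sum.union_disjoint) auto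
  finally have "(\<Sum>i=1..k. a i)\<^sup>2 \<le> (u + v)\<^sup>2"
    by (metis abs_ge_zero power2_abs power_mono)
  also have "\<dots> \<le> 2 * u\<^sup>2 + 2 * v\<^sup>2"
    using sum_squares_bound[of u v] by (simp add: power2_sum)
  also have "v\<^sup>2 \<le> (\<Sum>i=I..n. 1) * (\<Sum>i=I..n. \<bar>a i\<bar>\<^sup>2 / 1)"
    unfolding v_def by (rule weighted_Cauchy_Schwarz) simp
  also have "\<dots> \<le> real n * (\<Sum>i=I..n. (a i)\<^sup>2)"
    using assms by (auto intro!: mult_right_mono sum_nonneg)
  finally show ?thesis by (simp add: u_def)
qed

text \<open>
  For \<open>j < J\<close> the difference \<open>N j k - N j (k - j)\<close> only sees the last \<open>J\<close> times before \<open>k\<close>. The whole sum is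
  therefore at most \<open>J\<close> times the maximum of \<open>h\<close>, and the square of that maximum is at most
  \<open>K\<^sup>2\<close> plus the sum of the squares exceeding \<open>K\<^sup>2\<close>.
\<close>

lemma boundary_part_bound:
  fixes \<delta> :: "nat \<Rightarrow> nat \<Rightarrow> real" and J :: nat
  defines "N \<equiv> \<lambda>j k. \<Sum>l=1..k. \<delta> j l" and "h \<equiv> \<lambda>l. \<Sum>j<J. \<bar>\<delta> j l\<bar>"
  assumes "0 \<le> K" "k \<le> n"
  shows "(\<Sum>j<J. N j k - N j (k - j))\<^sup>2
    \<le> (real J)\<^sup>2 * (K\<^sup>2 + (\<Sum>l=1..n. if K < h l then (h l)\<^sup>2 else 0))"
proof -
  define r where "r = K\<^sup>2 + (\<Sum>l=1..n. if K < h l then (h l)\<^sup>2 else 0)"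
  have r_nonneg: "0 \<le> r" unfolding r_def by (intro add_nonneg_nonneg sum_nonneg) auto
  have h_nonneg: "0 \<le> h l" for l unfolding h_def by (simp add: sum_nonneg)
  have h_le: "h l \<le> sqrt r" if l: "l \<in> {1..n}" for l
  proof (rule real_le_rsqrt)
    have "(if K < h l then (h l)\<^sup>2 else 0) \<le> (\<Sum>l=1..n. if K < h l then (h l)\<^sup>2 else 0)"
      using l by (intro member_le_sum) auto
    moreover have "(h l)\<^sup>2 \<le> K\<^sup>2" if "\<not> K < h l"
      using that h_nonneg by (intro power_mono) auto
    ultimately show "(h l)\<^sup>2 \<le> r" unfolding r_def
      by (cases "K < h l") (auto intro: add_increasing2 add_increasing sum_nonneg)
  qed
  have N_diff: "N j k - N j (k - j) = (\<Sum>l\<in>{k - j<..k}. \<delta> j l)" for j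
  proof -
    have "{1..k} = {1..k - j} \<union> {k - j<..k}" by auto
    then have "N j k = N j (k - j) + (\<Sum>l\<in>{k - j<..k}. \<delta> j l)"
      unfolding N_def by (metis (no_types, lifting) finite_atLeastAtMost finite_greaterThanAtMost
          ivl_disj_int_two(8) sum.union_disjoint)
    then show ?thesis by simp
  qed
  have "\<bar>\<Sum>j<J. N j k - N j (k - j)\<bar> \<le> (\<Sum>j<J. \<bar>N j k - N j (k - j)\<bar>)" by (rule sum_abs)
  also have "\<dots> \<le> (\<Sum>j<J. \<Sum>l\<in>{k - J<..k}. \<bar>\<delta> j l\<bar>)"
  proof (rule sum_mono)
    fix j assume j: "j \<in> {..<J}"
    have "\<bar>N j k - N j (k - j)\<bar> \<le> (\<Sum>l\<in>{k - j<..k}. \<bar>\<delta> j l\<bar>)"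
      unfolding N_diff by (rule sum_abs)
    also have "\<dots> \<le> (\<Sum>l\<in>{k - J<..k}. \<bar>\<delta> j l\<bar>)"
      using j by (intro sum_mono2) auto
    finally show "\<bar>N j k - N j (k - j)\<bar> \<le> (\<Sum>l\<in>{k - J<..k}. \<bar>\<delta> j l\<bar>)" .
  qed
  also have "\<dots> = (\<Sum>l\<in>{k - J<..k}. h l)" unfolding h_def by (rule sum.swap)
  also have "\<dots> \<le> real (card {k - J<..k}) * sqrt r"
    using assms(4) by (intro sum_bounded_above h_le) auto
  also have "\<dots> \<le> real J * sqrt r"
    using r_nonneg by (intro mult_right_mono) auto
  finally have "(\<Sum>j<J. N j k - N j (k - j))\<^sup>2 \<le> (real J * sqrt r)\<^sup>2"
    by (metis abs_ge_zero power2_abs power_mono)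
  also have "\<dots> = (real J)\<^sup>2 * r" using r_nonneg by (simp add: power_mult_distrib)
  finally show ?thesis unfolding r_def .
qed

lemma late_part_bound:
  fixes N :: "nat \<Rightarrow> nat \<Rightarrow> real"
  assumes w: "\<And>j. 0 < w j" and k: "k \<le> n"
  shows "(\<Sum>j\<in>A. N j k - N j (k - j))\<^sup>2
    \<le> 4 * (\<Sum>j\<in>A. w j) * (\<Sum>j\<in>A. (MAX k\<in>{..n}. \<bar>N j k\<bar>)\<^sup>2 / w j)"
proof -
  have le: "(N j k - N j (k - j))\<^sup>2 \<le> 4 * (MAX k\<in>{..n}. \<bar>N j k\<bar>)\<^sup>2" for j
  proof -
    have "\<bar>N j k\<bar> \<le> (MAX k\<in>{..n}. \<bar>N j k\<bar>)" "\<bar>N j (k - j)\<bar> \<le> (MAX k\<in>{..n}. \<bar>N j k\<bar>)"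
      using k by (auto intro!: Max_ge)
    then have "\<bar>N j k - N j (k - j)\<bar> \<le> 2 * (MAX k\<in>{..n}. \<bar>N j k\<bar>)" by linarith
    then have "\<bar>N j k - N j (k - j)\<bar>\<^sup>2 \<le> (2 * (MAX k\<in>{..n}. \<bar>N j k\<bar>))\<^sup>2" by (intro power_mono) auto
    then show ?thesis by (simp add: power_mult_distrib)
  qed
  have "(\<Sum>j\<in>A. N j k - N j (k - j))\<^sup>2 \<le> (\<Sum>j\<in>A. w j) * (\<Sum>j\<in>A. (N j k - N j (k - j))\<^sup>2 / w j)"
    by (rule weighted_Cauchy_Schwarz) (rule w)
  also have "\<dots> \<le> (\<Sum>j\<in>A. w j) * (\<Sum>j\<in>A. 4 * (MAX k\<in>{..n}. \<bar>N j k\<bar>)\<^sup>2 / w j)"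
    using w le by (intro mult_left_mono sum_mono divide_right_mono sum_nonneg) (auto intro: less_imp_le)
  also have "\<dots> = 4 * (\<Sum>j\<in>A. w j) * (\<Sum>j\<in>A. (MAX k\<in>{..n}. \<bar>N j k\<bar>)\<^sup>2 / w j)"
    by (simp add: sum_distrib_left mult_ac)
  finally show ?thesis .
qed

text \<open>
  The three parts of the error: the conditional means \<open>a\<close>, the indices \<open>j < J\<close>, for which
  cancellation leaves boundedly many terms, and the indices \<open>j \<ge> J\<close>, for which the martingale
  maxima are estimated.
\<close>

lemma pathwise_error_bound:
  fixes \<delta> :: "nat \<Rightarrow> nat \<Rightarrow> real" and X a D :: "nat \<Rightarrow> real" and J :: nat
  defines "N \<equiv> \<lambda>j k. \<Sum>l=1..k. \<delta> j l" and "h \<equiv> \<lambda>l. \<Sum>j<J. \<bar>\<delta> j l\<bar>"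
  assumes X: "\<And>i. 1 \<le> i \<Longrightarrow> i \<le> n \<Longrightarrow> X i = a i + (\<Sum>l=1..i. \<delta> (i - l) l)"
    and D: "\<And>l. 1 \<le> l \<Longrightarrow> l \<le> n \<Longrightarrow> D l = (\<Sum>j\<le>p. \<delta> j l)"
    and p: "n \<le> p" "J \<le> p" and I: "1 \<le> I" and K: "0 \<le> K" and w: "\<And>j. 0 < w j"
    and k: "k \<le> n"
  shows "(\<Sum>i=1..k. X i - D i)\<^sup>2
    \<le> 6 * (\<Sum>i<I. \<bar>a i\<bar>)\<^sup>2 + 6 * (real n * (\<Sum>i=I..n. (a i)\<^sup>2))
      + 3 * (real J)\<^sup>2 * (K\<^sup>2 + (\<Sum>l=1..n. if K < h l then (h l)\<^sup>2 else 0))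
      + 12 * (\<Sum>j=J..p. w j) * (\<Sum>j=J..p. (MAX k\<in>{..n}. \<bar>N j k\<bar>)\<^sup>2 / w j)"
proof -
  define A where "A = (\<Sum>i=1..k. a i)"
  define B where "B = (\<Sum>j<J. N j k - N j (k - j))"
  define C where "C = (\<Sum>j=J..p. N j k - N j (k - j))"
  have "{..p} = {..<J} \<union> {J..p}" using p by auto
  then have "(\<Sum>j\<le>p. N j k - N j (k - j)) = B + C"
    unfolding B_def C_def by (metis (no_types, lifting) finite_atLeastAtMost finite_lessThan
        ivl_disj_int_one(4) sum.union_disjoint)
  moreover have "(\<Sum>i=1..k. X i - D i) = A - (\<Sum>j\<le>p. N j k - N j (k - j))"
    unfolding A_def N_def using k p X D by (intro pathwise_decomposition) auto
  ultimately have "(\<Sum>i=1..k. X i - D i) = A - B - C" by linarith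
  then have "(\<Sum>i=1..k. X i - D i)\<^sup>2 = (A - B - C)\<^sup>2" by (simp only:)
  also have "\<dots> \<le> 3 * A\<^sup>2 + 3 * B\<^sup>2 + 3 * C\<^sup>2"
  proof -
    have "0 \<le> (A + B)\<^sup>2 + (A + C)\<^sup>2 + (B - C)\<^sup>2" by simp
    then show ?thesis by (simp add: power2_eq_square algebra_simps)
  qed
  also have "A\<^sup>2 \<le> 2 * (\<Sum>i<I. \<bar>a i\<bar>)\<^sup>2 + 2 * (real n * (\<Sum>i=I..n. (a i)\<^sup>2))"
    unfolding A_def by (rule early_part_bound[OF I k])
  also have "B\<^sup>2 \<le> (real J)\<^sup>2 * (K\<^sup>2 + (\<Sum>l=1..n. if K < h l then (h l)\<^sup>2 else 0))"
    unfolding B_def N_def h_def by (rule boundary_part_bound[OF K k])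
  also have "C\<^sup>2 \<le> 4 * (\<Sum>j=J..p. w j) * (\<Sum>j=J..p. (MAX k\<in>{..n}. \<bar>N j k\<bar>)\<^sup>2 / w j)"
    unfolding C_def by (rule late_part_bound[OF w k])
  finally show ?thesis by (simp add: algebra_simps)
qed

section \<open>The maximal error and uniqueness\<close>

lemma truncation_integral_tendsto_0:
  assumes "in_L2 M h"
  shows "(\<lambda>K. \<integral>x. (if real K < h x then (h x)\<^sup>2 else 0) \<partial>M) \<longlonglongrightarrow> 0"
proof -
  have [measurable]: "h \<in> borel_measurable M" by (rule in_L2_D(1)[OF assms])
  have "(\<lambda>K. \<integral>x. (if real K < h x then (h x)\<^sup>2 else 0) \<partial>M) \<longlonglongrightarrow> (\<integral>x. 0 \<partial>M)"
  proof (rule integral_dominated_convergence[where w="\<lambda>x. (h x)\<^sup>2"])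
    have "(\<lambda>K. if real K < h x then (h x)\<^sup>2 else 0) \<longlonglongrightarrow> 0" for x
    proof (rule tendsto_eventually)
      obtain N :: nat where N: "h x \<le> real N" using real_arch_simple by blast
      show "eventually (\<lambda>K. (if real K < h x then (h x)\<^sup>2 else 0) = 0) sequentially"
        using eventually_ge_at_top[of N] by eventually_elim (use N in auto)
    qed
    then show "AE x in M. (\<lambda>K. if real K < h x then (h x)\<^sup>2 else 0) \<longlonglongrightarrow> 0" by simp
  qed (use in_L2_D(2)[OF assms] in auto)
  then show ?thesis by simp
qed

context filtered_mpt
begin

definition max_error :: "('a \<Rightarrow> real) \<Rightarrow> ('a \<Rightarrow> real) \<Rightarrow> nat \<Rightarrow> 'a \<Rightarrow> real" where
  "max_error Y e n x = (MAX k\<in>{1..n}. ((\<Sum>i=1..k. Y ((T ^^ i) x)) - mart_sum e k x)\<^sup>2)"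

lemma max_error_integrable:
  assumes "in_L2 M Y" "in_L2 M e" "1 \<le> n"
  shows "integrable M (max_error Y e n)"
proof -
  have "in_L2 M (\<lambda>x. MAX k\<in>{1..n}. \<bar>(\<Sum>i=1..k. Y ((T ^^ i) x)) - mart_sum e k x\<bar>)"
    using assms by (intro in_L2_Max_abs in_L2_diff in_L2_sum in_L2_T_pow in_L2_mart_sum) auto
  from in_L2_D(2)[OF this] show ?thesis
    unfolding max_error_def[abs_def] using assms(3) by (subst Max_power2_eq_power2_Max_abs) auto
qed

lemma max_error_ge:
  assumes "1 \<le> n"
  shows "((\<Sum>i=1..n. Y ((T ^^ i) x)) - mart_sum e n x)\<^sup>2 \<le> max_error Y e n x"
  unfolding max_error_def using assms by (intro Max_ge) auto

lemma max_error_nonneg: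
  assumes "1 \<le> n"
  shows "0 \<le> max_error Y e n x"
  using order_trans[OF zero_le_power2 max_error_ge[OF assms]] .

text \<open>
  Both martingales are within \<open>o(\<surd>n)\<close> in \<open>L\<^sup>2\<close> of the same sums, while by orthogonality of the
  increments the square of the norm of their difference is exactly \<open>n\<close> times that of \<open>e - e'\<close>.
\<close>

lemma martingale_approximation_unique:
  assumes Y: "in_L2 M Y"
    and e: "e \<in> borel_measurable F0" "in_L2 M e" "AE x in M. E0 (\<lambda>x. e (T x)) x = 0"
    and e': "e' \<in> borel_measurable F0" "in_L2 M e'" "AE x in M. E0 (\<lambda>x. e' (T x)) x = 0"
    and lim: "(\<lambda>n. \<integral>x. \<bar>1 / real n * E0 (max_error Y e n) x\<bar> \<partial>M) \<longlonglongrightarrow> 0"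
    and lim': "(\<lambda>n. \<integral>x. \<bar>1 / real n * E0 (max_error Y e' n) x\<bar> \<partial>M) \<longlonglongrightarrow> 0"
  shows "AE x in M. e x = e' x"
proof -
  define f where "f x = e x - e' x" for x
  have f_F0: "f \<in> borel_measurable F0" unfolding f_def[abs_def] using e(1) e'(1) by measurable
  have f_L2: "in_L2 M f" unfolding f_def[abs_def] by (intro in_L2_diff e e')
  have "AE x in M. E0 (\<lambda>x. f (T x)) x = E0 (\<lambda>x. e (T x)) x - E0 (\<lambda>x. e' (T x)) x"
    unfolding f_def
    by (intro real_cond_exp_diff integrable_compose[OF T distr_T integrable_L2[OF e(2)]]
        integrable_compose[OF T distr_T integrable_L2[OF e'(2)]])
  with e(3) e'(3) have f_diff: "AE x in M. E0 (\<lambda>x. f (T x)) x = 0"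
    by eventually_elim simp
  have le: "(\<integral>x. max_error Y u n x \<partial>M) \<le> real n * (\<integral>x. \<bar>1 / real n * E0 (max_error Y u n) x\<bar> \<partial>M)"
    if u: "in_L2 M u" and n: "1 \<le> n" for u n
  proof -
    note int = max_error_integrable[OF Y u n]
    have "(\<integral>x. max_error Y u n x \<partial>M) = (\<integral>x. E0 (max_error Y u n) x \<partial>M)"
      by (rule real_cond_exp_int(2)[OF int, symmetric])
    also have "\<dots> \<le> (\<integral>x. \<bar>E0 (max_error Y u n) x\<bar> \<partial>M)"
      using real_cond_exp_int(1)[OF int] by (intro integral_mono) auto
    also have "\<dots> = real n * (\<integral>x. \<bar>1 / real n * E0 (max_error Y u n) x\<bar> \<partial>M)"
      using n by (simp add: abs_mult)
    finally show ?thesis .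
  qed
  have "(\<integral>x. (f x)\<^sup>2 \<partial>M) \<le> 2 * (\<integral>x. \<bar>1 / real n * E0 (max_error Y e n) x\<bar> \<partial>M)
      + 2 * (\<integral>x. \<bar>1 / real n * E0 (max_error Y e' n) x\<bar> \<partial>M)" (is "_ \<le> 2 * ?u + 2 * ?v")
    if n: "1 \<le> n" for n
  proof -
    have "(mart_sum f n x)\<^sup>2 \<le> 2 * max_error Y e n x + 2 * max_error Y e' n x" for x
    proof -
      let ?s = "(\<Sum>i=1..n. Y ((T ^^ i) x))"
      have "mart_sum f n x = (?s - mart_sum e' n x) - (?s - mart_sum e n x)"
        unfolding mart_sum_def f_def by (simp add: sum_subtractf)
      moreover have "(u - v)\<^sup>2 \<le> 2 * v\<^sup>2 + 2 * u\<^sup>2" for u v :: real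
        using zero_le_power2[of "u + v"] by (simp add: power2_eq_square algebra_simps)
      ultimately have "(mart_sum f n x)\<^sup>2 \<le> 2 * (?s - mart_sum e n x)\<^sup>2 + 2 * (?s - mart_sum e' n x)\<^sup>2"
        by metis
      then show ?thesis
        using max_error_ge[OF n, of Y x e] max_error_ge[OF n, of Y x e'] by linarith
    qed
    then have "(\<integral>x. (mart_sum f n x)\<^sup>2 \<partial>M) \<le> (\<integral>x. 2 * max_error Y e n x + 2 * max_error Y e' n x \<partial>M)"
      by (intro integral_mono in_L2_D(2)[OF in_L2_mart_sum[OF f_L2]] Bochner_Integration.integrable_add
          integrable_mult_right max_error_integrable Y e(2) e'(2) n)
    also have "\<dots> = 2 * (\<integral>x. max_error Y e n x \<partial>M) + 2 * (\<integral>x. max_error Y e' n x \<partial>M)"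
      using max_error_integrable[OF Y e(2) n] max_error_integrable[OF Y e'(2) n] by simp
    also have "\<dots> \<le> 2 * (real n * ?u) + 2 * (real n * ?v)"
      using le[OF e(2) n] le[OF e'(2) n] by linarith
    finally have "real n * (\<integral>x. (f x)\<^sup>2 \<partial>M) \<le> real n * (2 * ?u + 2 * ?v)"
      unfolding mart_sum_second_moment[OF f_F0 f_L2 f_diff] by (simp only: algebra_simps)
    then show ?thesis using n by simp
  qed
  then have "(\<integral>x. (f x)\<^sup>2 \<partial>M) \<le> 2 * 0 + 2 * 0"
    by (intro LIMSEQ_le_const[OF tendsto_add[OF tendsto_mult[OF tendsto_const lim] tendsto_mult[OF tendsto_const lim']]])
      blast
  then have "(\<integral>x. (f x)\<^sup>2 \<partial>M) = 0"
    by (simp add: order_antisym)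
  then have "AE x in M. (f x)\<^sup>2 = 0"
    using in_L2_D(2)[OF f_L2] by (subst (asm) integral_nonneg_eq_0_iff_AE) auto
  then show ?thesis by (simp add: f_def)
qed

end


section \<open>Series of martingale differences\<close>

lemma suminf_tail_split:
  fixes f :: "nat \<Rightarrow> real"
  assumes "summable f" "J \<le> p"
  shows "(\<Sum>i. f (i + J)) = (\<Sum>j=J..<p. f j) + (\<Sum>i. f (i + p))"
proof -
  have "(\<Sum>j<p. f j) = (\<Sum>j<J. f j) + (\<Sum>j=J..<p. f j)"
    using assms(2) sum.atLeastLessThan_concat[of 0 J p f] by (simp add: lessThan_atLeast0)
  then show ?thesis
    using suminf_minus_initial_segment[OF assms(1), of J] suminf_minus_initial_segment[OF assms(1), of p]
    by simp
qed

lemma norm_L2_nonneg [simp]: "0 \<le> norm_L2 M f"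
  by (simp add: norm_L2_def)

lemma norm_L2_power2: "(norm_L2 M f)\<^sup>2 = (\<integral>x. (f x)\<^sup>2 \<partial>M)"
  by (simp add: norm_L2_def)

text \<open>
  The data from which the approximation is built. In the application \<open>a j\<close> is \<open>E(X\<^sub>j | F0)\<close> and \<open>d j\<close> is
  \<open>P\<^sub>0(X\<^sub>j)\<close>; the assumption \<open>decomp\<close> is the expansion of \<open>X\<^sub>i - E(X\<^sub>i | F0)\<close> into martingale differences.
\<close>

locale hannan_decomposition = filtered_mpt M F0 T
  for M F0 :: "'a measure" and T :: "'a \<Rightarrow> 'a" +
  fixes X :: "'a \<Rightarrow> real" and a d :: "nat \<Rightarrow> 'a \<Rightarrow> real"
  assumes X_L2: "in_L2 M X"
    and a_F0: "\<And>j. a j \<in> borel_measurable F0"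
    and a_L2: "\<And>j. in_L2 M (a j)"
    and a_sum: "summable (\<lambda>j. \<integral>x. (a j x)\<^sup>2 \<partial>M)"
    and d_F0: "\<And>j. d j \<in> borel_measurable F0"
    and d_L2: "\<And>j. in_L2 M (d j)"
    and d_sum: "summable (\<lambda>j. norm_L2 M (d j))"
    and d_diff: "\<And>j. AE x in M. E0 (\<lambda>x. d j (T x)) x = 0"
    and decomp: "\<And>i. AE x in M. X ((T ^^ i) x) = a i x + (\<Sum>l=1..i. d (i - l) ((T ^^ l) x))"
begin

text \<open>
  The geometric term only serves to make the weights positive. The function \<open>tail_energy J\<close> has
  mean at most \<open>tail_weight J\<close>, and it is the function whose ergodic averages dominate the
  martingale part of the error with indices \<open>j \<ge> J\<close>.
\<close>

definition weight :: "nat \<Rightarrow> real" where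
  "weight j = norm_L2 M (d j) + (1 / 2) ^ j"

definition tail_weight :: "nat \<Rightarrow> real" where
  "tail_weight J = (\<Sum>i. weight (i + J))"

definition tail_energy :: "nat \<Rightarrow> 'a \<Rightarrow> real" where
  "tail_energy J x = (\<Sum>i. (d (i + J) x)\<^sup>2 / weight (i + J))"

definition D :: "'a \<Rightarrow> real" where
  "D x = (\<Sum>j. d j x)"

definition tail_sum :: "nat \<Rightarrow> 'a \<Rightarrow> real" where
  "tail_sum p x = D x - (\<Sum>j<p. d j x)"

lemma weight_pos [simp]: "0 < weight j"
  unfolding weight_def by (intro add_nonneg_pos) auto

lemma weight_summable: "summable weight"
  unfolding weight_def[abs_def] by (intro summable_add d_sum summable_geometric) simp

lemma tail_weight_pos: "0 < tail_weight J"
  unfolding tail_weight_def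
  by (rule suminf_pos) (auto intro: summable_ignore_initial_segment weight_summable)

lemma tail_weight_tendsto: "tail_weight \<longlonglongrightarrow> 0"
  unfolding tail_weight_def[abs_def] by (rule tail_series_tendsto_0[OF weight_summable])

lemma ratio_integrable: "integrable M (\<lambda>x. (d j x)\<^sup>2 / weight j)"
  using in_L2_D(2)[OF d_L2] by simp

lemma ratio_nonneg: "0 \<le> (d j x)\<^sup>2 / weight j"
  by (simp add: less_imp_le)

lemma ratio_integral_le: "(\<integral>x. (d j x)\<^sup>2 / weight j \<partial>M) \<le> weight j"
proof -
  have "(norm_L2 M (d j))\<^sup>2 \<le> (weight j)\<^sup>2"
    unfolding weight_def by (intro power_mono) auto
  then have "(\<integral>x. (d j x)\<^sup>2 \<partial>M) \<le> weight j * weight j"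
    by (simp add: norm_L2_power2 power2_eq_square[of "weight j"])
  then show ?thesis
    by (simp add: divide_le_eq)
qed

lemma ratio_integral_summable: "summable (\<lambda>j. \<integral>x. (d j x)\<^sup>2 / weight j \<partial>M)"
proof (rule summable_comparison_test[OF _ weight_summable])
  have "norm (\<integral>x. (d j x)\<^sup>2 / weight j \<partial>M) = (\<integral>x. (d j x)\<^sup>2 / weight j \<partial>M)" for j
    using ratio_nonneg by (simp add: integral_nonneg_AE less_imp_le)
  then show "\<exists>N. \<forall>j\<ge>N. norm (\<integral>x. (d j x)\<^sup>2 / weight j \<partial>M) \<le> weight j"
    using ratio_integral_le by metis
qed

lemmas ratio_series = ratio_integrable ratio_nonneg ratio_integral_summable

lemma tail_energy_integrable: "integrable M (tail_energy J)"
  unfolding tail_energy_def[abs_def] by (rule integrable_tail_series[OF ratio_series])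

lemma tail_energy_integral_le: "(\<integral>x. tail_energy J x \<partial>M) \<le> tail_weight J"
  unfolding tail_energy_def tail_weight_def integral_tail_series[OF ratio_series]
  by (intro suminf_le ratio_integral_le summable_ignore_initial_segment weight_summable
      ratio_integral_summable)

lemma AE_summable_ratio: "AE x in M. summable (\<lambda>j. (d j x)\<^sup>2 / weight j)"
  by (rule AE_summable_if_summable_integral[OF ratio_series])

lemma tail_energy_nonneg:
  assumes "summable (\<lambda>j. (d j x)\<^sup>2 / weight j)"
  shows "0 \<le> tail_energy J x"
  unfolding tail_energy_def by (intro suminf_nonneg ratio_nonneg summable_ignore_initial_segment assms)

text \<open>
  By the inequality of the means \<open>\<bar>d\<^sub>j\<bar> \<le> w\<^sub>j + d\<^sub>j\<^sup>2 / w\<^sub>j\<close>, so the series defining \<open>D\<close> converges absolutely at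
  almost every point, and pointwise identities for its tails are available.
\<close>

lemma summable_of_summable_ratio:
  assumes "summable (\<lambda>j. (d j x)\<^sup>2 / weight j)"
  shows "summable (\<lambda>j. d j x)"
proof (rule summable_comparison_test)
  show "summable (\<lambda>j. weight j + (d j x)\<^sup>2 / weight j)"
    by (intro summable_add weight_summable assms)
  have "\<bar>d j x\<bar> \<le> weight j + (d j x)\<^sup>2 / weight j" for j
  proof -
    have "2 * weight j * \<bar>d j x\<bar> \<le> (weight j)\<^sup>2 + (d j x)\<^sup>2"
      using sum_squares_bound[of "weight j" "\<bar>d j x\<bar>"] by simp
    moreover have "0 \<le> weight j * \<bar>d j x\<bar>" by (simp add: less_imp_le)
    ultimately have "weight j * \<bar>d j x\<bar> \<le> (weight j)\<^sup>2 + (d j x)\<^sup>2" by linarith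
    then have "\<bar>d j x\<bar> \<le> ((weight j)\<^sup>2 + (d j x)\<^sup>2) / weight j"
      by (simp add: pos_le_divide_eq mult.commute)
    then show ?thesis by (simp add: add_divide_distrib power2_eq_square)
  qed
  then show "\<exists>N. \<forall>j\<ge>N. norm (d j x) \<le> weight j + (d j x)\<^sup>2 / weight j" by simp
qed

lemma tail_sum_square_le:
  assumes "summable (\<lambda>j. (d j x)\<^sup>2 / weight j)"
  shows "(tail_sum p x)\<^sup>2 \<le> tail_weight p * tail_energy p x"
proof -
  note s = summable_of_summable_ratio[OF assms]
  have "tail_sum p x = (\<Sum>i. d (i + p) x)"
    unfolding tail_sum_def D_def using suminf_minus_initial_segment[OF s, of p] by simp
  then show ?thesis
    unfolding tail_weight_def tail_energy_def
    using weighted_Cauchy_Schwarz_suminf[of "\<lambda>i. weight (i + p)" "\<lambda>i. d (i + p) x"]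
      summable_ignore_initial_segment[OF weight_summable, of p] summable_ignore_initial_segment[OF s, of p]
      summable_ignore_initial_segment[OF assms, of p]
    by simp
qed

lemma D_F0: "D \<in> borel_measurable F0"
  unfolding D_def[abs_def] using d_F0 by measurable

lemma tail_sum_F0: "tail_sum p \<in> borel_measurable F0"
  unfolding tail_sum_def[abs_def] using d_F0 D_F0 by measurable

lemma tail_sum_L2: "in_L2 M (tail_sum p)"
proof -
  have m: "tail_sum p \<in> borel_measurable M" by (rule measurable_F0_M[OF tail_sum_F0])
  have "integrable M (\<lambda>x. (tail_sum p x)\<^sup>2)"
  proof (rule Bochner_Integration.integrable_bound)
    show "integrable M (\<lambda>x. tail_weight p * tail_energy p x)" using tail_energy_integrable by simp
    show "AE x in M. norm ((tail_sum p x)\<^sup>2) \<le> norm (tail_weight p * tail_energy p x)"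
      using AE_summable_ratio
      by eventually_elim (auto intro: order_trans[OF tail_sum_square_le])
  qed (use m in measurable)
  with m show ?thesis by (simp add: in_L2_def)
qed

lemma tail_sum_integral_le: "(\<integral>x. (tail_sum p x)\<^sup>2 \<partial>M) \<le> (tail_weight p)\<^sup>2"
proof -
  have "(\<integral>x. (tail_sum p x)\<^sup>2 \<partial>M) \<le> (\<integral>x. tail_weight p * tail_energy p x \<partial>M)"
    using AE_summable_ratio tail_energy_integrable in_L2_D(2)[OF tail_sum_L2]
    by (intro integral_mono_AE) (auto elim!: eventually_mono intro: tail_sum_square_le)
  also have "\<dots> \<le> tail_weight p * tail_weight p"
    using tail_energy_integral_le[of p] tail_weight_pos[of p] by simp
  finally show ?thesis by (simp add: power2_eq_square)
qed

lemma D_L2: "in_L2 M D"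
  using tail_sum_L2[of 0] by (simp add: tail_sum_def[abs_def])

lemma sums_L2_D: "sums_L2 M d D"
proof -
  have "norm_L2 M (\<lambda>x. (\<Sum>k<n. d k x) - D x) \<le> tail_weight n" for n
  proof -
    have "(\<integral>x. ((\<Sum>k<n. d k x) - D x)\<^sup>2 \<partial>M) = (\<integral>x. (tail_sum n x)\<^sup>2 \<partial>M)"
      unfolding tail_sum_def by (simp add: power2_commute)
    then show ?thesis
      using tail_sum_integral_le[of n] tail_weight_pos[of n] by (simp add: norm_L2_def real_le_lsqrt)
  qed
  then have "(\<lambda>n. norm_L2 M (\<lambda>x. (\<Sum>k<n. d k x) - D x)) \<longlonglongrightarrow> 0"
    by (intro tendsto_sandwich[OF _ _ tendsto_const tail_weight_tendsto]) auto
  then show ?thesis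
    by (simp add: sums_L2_def d_L2 D_L2)
qed

lemma integrable_d_T: "integrable M (\<lambda>x. d j (T x))"
  by (rule integrable_compose[OF T distr_T integrable_L2[OF d_L2]])

lemma integrable_tail_sum_T: "integrable M (\<lambda>x. tail_sum p (T x))"
  by (rule integrable_compose[OF T distr_T integrable_L2[OF tail_sum_L2]])

lemma integrable_D_T: "integrable M (\<lambda>x. D (T x))"
  by (rule integrable_compose[OF T distr_T integrable_L2[OF D_L2]])

lemma tail_sum_cond_exp: "AE x in M. E0 (\<lambda>x. tail_sum p (T x)) x = E0 (\<lambda>x. D (T x)) x"
proof -
  have "AE x in M. E0 (\<lambda>x. tail_sum p (T x)) x = E0 (\<lambda>x. D (T x)) x - E0 (\<lambda>x. \<Sum>j<p. d j (T x)) x"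
    unfolding tail_sum_def
    by (intro real_cond_exp_diff integrable_D_T Bochner_Integration.integrable_sum integrable_d_T)
  moreover have "AE x in M. E0 (\<lambda>x. \<Sum>j<p. d j (T x)) x = (\<Sum>j<p. E0 (\<lambda>x. d j (T x)) x)"
    by (intro real_cond_exp_sum integrable_d_T)
  moreover have "AE x in M. \<forall>j. E0 (\<lambda>x. d j (T x)) x = 0"
    unfolding AE_all_countable using d_diff by blast
  ultimately show ?thesis by eventually_elim simp
qed

lemma D_diff: "AE x in M. E0 (\<lambda>x. D (T x)) x = 0"
proof -
  \<comment> \<open>\<open>D \<circ> T\<close> and every tail have the same conditional mean, and the tails are small in \<open>L\<^sup>1\<close>.\<close>
  have bound: "(\<integral>x. \<bar>E0 (\<lambda>x. D (T x)) x\<bar> \<partial>M) \<le> 2 * tail_weight p" for p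
  proof -
    have "AE x in M. \<bar>E0 (\<lambda>x. D (T x)) x\<bar> \<le> E0 (\<lambda>x. \<bar>tail_sum p (T x)\<bar>) x"
    proof -
      have 1: "AE x in M. E0 (\<lambda>x. tail_sum p (T x)) x \<le> E0 (\<lambda>x. \<bar>tail_sum p (T x)\<bar>) x"
        by (intro real_cond_exp_mono integrable_tail_sum_T integrable_abs) auto
      have 2: "AE x in M. E0 (\<lambda>x. -1 * tail_sum p (T x)) x \<le> E0 (\<lambda>x. \<bar>tail_sum p (T x)\<bar>) x"
        by (intro real_cond_exp_mono integrable_tail_sum_T integrable_abs integrable_mult_right) auto
      have 3: "AE x in M. E0 (\<lambda>x. -1 * tail_sum p (T x)) x = -1 * E0 (\<lambda>x. tail_sum p (T x)) x"
        by (rule real_cond_exp_cmult[OF integrable_tail_sum_T])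
      from 1 2 3 tail_sum_cond_exp[of p] show ?thesis by eventually_elim simp
    qed
    then have "(\<integral>x. \<bar>E0 (\<lambda>x. D (T x)) x\<bar> \<partial>M) \<le> (\<integral>x. E0 (\<lambda>x. \<bar>tail_sum p (T x)\<bar>) x \<partial>M)"
      by (intro integral_mono_AE integrable_abs real_cond_exp_int(1) integrable_D_T integrable_tail_sum_T)
    also have "\<dots> = (\<integral>x. \<bar>tail_sum p (T x)\<bar> \<partial>M)"
      by (intro real_cond_exp_int(2) integrable_abs integrable_tail_sum_T)
    also have "\<dots> = (\<integral>x. \<bar>tail_sum p x\<bar> \<partial>M)"
      using integral_compose[OF T distr_T, of "\<lambda>x. \<bar>tail_sum p x\<bar>"] in_L2_D(1)[OF tail_sum_L2[of p]] by simp
    also have "\<dots> \<le> (\<integral>x. tail_weight p + tail_energy p x \<partial>M)"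
    proof (rule integral_mono_AE)
      show "AE x in M. \<bar>tail_sum p x\<bar> \<le> tail_weight p + tail_energy p x"
        using AE_summable_ratio
      proof eventually_elim
        case (elim x)
        note g0 = tail_energy_nonneg[OF elim, of p]
        then have "\<bar>tail_sum p x\<bar>\<^sup>2 \<le> (tail_weight p + tail_energy p x)\<^sup>2"
          using tail_sum_square_le[OF elim, of p] mult_nonneg_nonneg[OF less_imp_le[OF tail_weight_pos[of p]], of "tail_energy p x"]
            zero_le_power2[of "tail_weight p"] zero_le_power2[of "tail_energy p x"]
          unfolding power2_sum power2_abs mult.assoc by linarith
        then show ?case
          using g0 tail_weight_pos[of p] by (intro power2_le_imp_le[of "\<bar>tail_sum p x\<bar>"]) auto
      qed
    qed (use tail_energy_integrable integrable_L2[OF tail_sum_L2] in auto)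
    also have "\<dots> \<le> 2 * tail_weight p"
      using tail_energy_integrable tail_energy_integral_le[of p] by (simp add: prob_space)
    finally show ?thesis .
  qed
  have "(\<integral>x. \<bar>E0 (\<lambda>x. D (T x)) x\<bar> \<partial>M) \<le> 2 * 0"
    by (rule LIMSEQ_le_const[OF tendsto_mult[OF tendsto_const tail_weight_tendsto]]) (use bound in auto)
  moreover have "0 \<le> (\<integral>x. \<bar>E0 (\<lambda>x. D (T x)) x\<bar> \<partial>M)" by simp
  ultimately have "(\<integral>x. \<bar>E0 (\<lambda>x. D (T x)) x\<bar> \<partial>M) = 0" by simp
  then have "AE x in M. \<bar>E0 (\<lambda>x. D (T x)) x\<bar> = 0"
    using real_cond_exp_int(1)[OF integrable_D_T]
    by (subst (asm) integral_nonneg_eq_0_iff_AE) auto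
  then show ?thesis by simp
qed

lemma tail_sum_diff: "AE x in M. E0 (\<lambda>x. tail_sum p (T x)) x = 0"
  using tail_sum_cond_exp[of p] D_diff by eventually_elim simp

section \<open>The conditional error bound\<close>

text \<open>
  For times up to \<open>n \<le> p\<close> all \<open>d\<^sub>j\<close> with \<open>j \<ge> p\<close> act in the same way on the partial sums, so they are
  merged into a single martingale difference with index \<open>p\<close>. This leaves finitely many
  martingales, and conditional expectations have to be exchanged with finite sums only.
\<close>

definition piece :: "nat \<Rightarrow> nat \<Rightarrow> 'a \<Rightarrow> real" where
  "piece p j = (if j < p then d j else tail_sum p)"

definition piece_weight :: "nat \<Rightarrow> nat \<Rightarrow> real" where
  "piece_weight p j = (if j < p then weight j else tail_weight p)"

lemma piece_F0: "piece p j \<in> borel_measurable F0"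
  by (simp add: piece_def d_F0 tail_sum_F0)

lemma piece_L2: "in_L2 M (piece p j)"
  by (simp add: piece_def d_L2 tail_sum_L2)

lemma piece_diff: "AE x in M. E0 (\<lambda>x. piece p j (T x)) x = 0"
  by (cases "j < p") (simp_all add: piece_def d_diff tail_sum_diff)

lemma piece_weight_pos: "0 < piece_weight p j"
  by (simp add: piece_weight_def tail_weight_pos)

lemma piece_sum: "(\<Sum>j\<le>p. piece p j x) = D x"
proof -
  have "(\<Sum>j\<le>p. piece p j x) = (\<Sum>j<p. piece p j x) + piece p p x"
    by (simp add: lessThan_Suc_atMost[symmetric])
  then show ?thesis by (simp add: piece_def tail_sum_def)
qed

lemma piece_weight_sum:
  assumes "J \<le> p"
  shows "(\<Sum>j=J..p. piece_weight p j) = tail_weight J"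
proof -
  have "(\<Sum>j=J..p. piece_weight p j) = (\<Sum>j=J..<p. piece_weight p j) + piece_weight p p"
    using assms by (simp add: atLeastLessThanSuc_atLeastAtMost[symmetric])
  also have "\<dots> = (\<Sum>j=J..<p. weight j) + tail_weight p"
    by (simp add: piece_weight_def)
  finally show ?thesis
    unfolding tail_weight_def suminf_tail_split[OF weight_summable assms] .
qed

lemma piece_ratio_sum_le:
  assumes "J \<le> p" "summable (\<lambda>j. (d j x)\<^sup>2 / weight j)"
  shows "(\<Sum>j=J..p. (piece p j x)\<^sup>2 / piece_weight p j) \<le> tail_energy J x"
proof -
  have "(\<Sum>j=J..p. (piece p j x)\<^sup>2 / piece_weight p j) = (\<Sum>j=J..<p. (piece p j x)\<^sup>2 / piece_weight p j) + (piece p p x)\<^sup>2 / piece_weight p p"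
    using assms(1) by (simp add: atLeastLessThanSuc_atLeastAtMost[symmetric])
  also have "\<dots> = (\<Sum>j=J..<p. (d j x)\<^sup>2 / weight j) + (tail_sum p x)\<^sup>2 / tail_weight p"
    by (simp add: piece_def piece_weight_def)
  also have "(tail_sum p x)\<^sup>2 / tail_weight p \<le> tail_energy p x"
    using tail_sum_square_le[OF assms(2), of p] tail_weight_pos[of p] by (simp add: pos_divide_le_eq mult.commute)
  finally show ?thesis
    unfolding tail_energy_def suminf_tail_split[OF assms(2,1)] by simp
qed

definition piece_max :: "nat \<Rightarrow> nat \<Rightarrow> nat \<Rightarrow> 'a \<Rightarrow> real" where
  "piece_max p n j x = (MAX k\<in>{..n}. \<bar>mart_sum (piece p j) k x\<bar>)"

lemma piece_max_L2: "in_L2 M (piece_max p n j)"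
  unfolding piece_max_def[abs_def] by (intro in_L2_Max_abs in_L2_mart_sum piece_L2) auto

text \<open>
  The conditional Doob inequality is applied to each piece; the pieces are then recombined, at
  each time \<open>l\<close>, into \<open>tail_energy J\<close>. The resulting bound depends on \<open>p\<close> no longer.
\<close>

lemma cond_exp_late_part:
  assumes J: "J \<le> p" and c: "0 \<le> c"
  shows "AE x in M. E0 (\<lambda>x. c * (\<Sum>j=J..p. (piece_max p n j x)\<^sup>2 / piece_weight p j)) x
    \<le> (\<Sum>l=1..n. E0 (\<lambda>x. 4 * c * tail_energy J ((T ^^ l) x)) x)"
proof -
  note mint = in_L2_D(2)[OF piece_max_L2]
  note eint = integrable_square_T_pow[OF piece_L2]
  have lin: "AE x in M. E0 (\<lambda>x. b * (\<Sum>j=J..p. f j x / piece_weight p j)) x = b * (\<Sum>j=J..p. E0 (f j) x / piece_weight p j)"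
    if f: "\<And>j. integrable M (f j)" for f and b
  proof -
    have "AE x in M. E0 (\<lambda>x. b * (\<Sum>j=J..p. f j x / piece_weight p j)) x = b * E0 (\<lambda>x. \<Sum>j=J..p. f j x / piece_weight p j) x"
      by (intro real_cond_exp_cmult Bochner_Integration.integrable_sum integrable_divide f)
    moreover have "AE x in M. E0 (\<lambda>x. \<Sum>j=J..p. f j x / piece_weight p j) x = (\<Sum>j=J..p. E0 (\<lambda>x. f j x / piece_weight p j) x)"
      by (intro real_cond_exp_sum integrable_divide f)
    moreover have "AE x in M. \<forall>j. E0 (\<lambda>x. f j x / piece_weight p j) x = E0 (f j) x / piece_weight p j"
      unfolding AE_all_countable by (intro allI real_cond_exp_cdiv f)
    ultimately show ?thesis by eventually_elim simp
  qed
  have "AE x in M. \<forall>j. E0 (\<lambda>x. (piece_max p n j x)\<^sup>2) x \<le> 4 * (\<Sum>l=1..n. E0 (\<lambda>x. (piece p j ((T ^^ l) x))\<^sup>2) x)"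
    unfolding AE_all_countable piece_max_def by (intro allI conditional_Doob piece_F0 piece_L2 piece_diff)
  moreover have "AE x in M. E0 (\<lambda>x. c * (\<Sum>j=J..p. (piece_max p n j x)\<^sup>2 / piece_weight p j)) x
      = c * (\<Sum>j=J..p. E0 (\<lambda>x. (piece_max p n j x)\<^sup>2) x / piece_weight p j)"
    by (rule lin[OF mint])
  moreover have "AE x in M. \<forall>l. E0 (\<lambda>x. 4 * c * (\<Sum>j=J..p. (piece p j ((T ^^ l) x))\<^sup>2 / piece_weight p j)) x
      = 4 * c * (\<Sum>j=J..p. E0 (\<lambda>x. (piece p j ((T ^^ l) x))\<^sup>2) x / piece_weight p j)"
    unfolding AE_all_countable by (intro allI lin eint)
  moreover have "AE x in M. \<forall>l. E0 (\<lambda>x. 4 * c * (\<Sum>j=J..p. (piece p j ((T ^^ l) x))\<^sup>2 / piece_weight p j)) x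
      \<le> E0 (\<lambda>x. 4 * c * tail_energy J ((T ^^ l) x)) x"
    unfolding AE_all_countable
  proof
    fix l
    show "AE x in M. E0 (\<lambda>x. 4 * c * (\<Sum>j=J..p. (piece p j ((T ^^ l) x))\<^sup>2 / piece_weight p j)) x
      \<le> E0 (\<lambda>x. 4 * c * tail_energy J ((T ^^ l) x)) x"
    proof (rule real_cond_exp_mono)
      show "AE x in M. 4 * c * (\<Sum>j=J..p. (piece p j ((T ^^ l) x))\<^sup>2 / piece_weight p j) \<le> 4 * c * tail_energy J ((T ^^ l) x)"
        using AE_T_pow[OF AE_summable_ratio, of l]
        by eventually_elim (intro mult_left_mono piece_ratio_sum_le J, use c in auto)
      show "integrable M (\<lambda>x. 4 * c * tail_energy J ((T ^^ l) x))"
        by (intro integrable_mult_right integrable_T_pow[OF tail_energy_integrable])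
    qed (intro integrable_mult_right Bochner_Integration.integrable_sum integrable_divide eint)
  qed
  ultimately show ?thesis
  proof eventually_elim
    case (elim x)
    have "E0 (\<lambda>x. c * (\<Sum>j=J..p. (piece_max p n j x)\<^sup>2 / piece_weight p j)) x
        = c * (\<Sum>j=J..p. E0 (\<lambda>x. (piece_max p n j x)\<^sup>2) x / piece_weight p j)" by (rule elim(2))
    also have "\<dots> \<le> c * (\<Sum>j=J..p. (4 * (\<Sum>l=1..n. E0 (\<lambda>x. (piece p j ((T ^^ l) x))\<^sup>2) x)) / piece_weight p j)"
      using elim(1) c by (intro mult_left_mono sum_mono divide_right_mono less_imp_le[OF piece_weight_pos]) auto
    also have "\<dots> = 4 * c * (\<Sum>j=J..p. \<Sum>l=1..n. E0 (\<lambda>x. (piece p j ((T ^^ l) x))\<^sup>2) x / piece_weight p j)"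
      by (simp only: sum_divide_distrib[symmetric] times_divide_eq_right[symmetric]
          sum_distrib_left[symmetric])
    also have "\<dots> = 4 * c * (\<Sum>l=1..n. \<Sum>j=J..p. E0 (\<lambda>x. (piece p j ((T ^^ l) x))\<^sup>2) x / piece_weight p j)"
      by (subst sum.swap) (rule refl)
    also have "\<dots> = (\<Sum>l=1..n. 4 * c * (\<Sum>j=J..p. E0 (\<lambda>x. (piece p j ((T ^^ l) x))\<^sup>2) x / piece_weight p j))"
      by (rule sum_distrib_left)
    also have "\<dots> \<le> (\<Sum>l=1..n. E0 (\<lambda>x. 4 * c * tail_energy J ((T ^^ l) x)) x)"
      by (rule sum_mono, rule ord_eq_le_trans[OF elim(3)[THEN spec, symmetric] elim(4)[THEN spec]])
    finally show ?case .
  qed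
qed

lemma a_tail_integrable: "integrable M (\<lambda>x. \<Sum>i. (a (i + I) x)\<^sup>2)"
  by (rule integrable_tail_series[OF in_L2_D(2)[OF a_L2] zero_le_power2 a_sum])

lemma a_tail_integral: "(\<integral>x. (\<Sum>i. (a (i + I) x)\<^sup>2) \<partial>M) = (\<Sum>i. \<integral>x. (a (i + I) x)\<^sup>2 \<partial>M)"
  by (rule integral_tail_series[OF in_L2_D(2)[OF a_L2] zero_le_power2 a_sum])

lemma AE_summable_a: "AE x in M. summable (\<lambda>i. (a i x)\<^sup>2)"
  by (rule AE_summable_if_summable_integral[OF in_L2_D(2)[OF a_L2] zero_le_power2 a_sum])

text \<open>
  The part of the error with \<open>j < J\<close> is governed by the large values of \<open>head_sum J\<close>, whose square
  is integrable; truncation at a high level \<open>K\<close> makes their mean small.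
\<close>

definition head_sum :: "nat \<Rightarrow> 'a \<Rightarrow> real" where
  "head_sum J x = (\<Sum>j<J. \<bar>d j x\<bar>)"

lemma head_sum_L2: "in_L2 M (head_sum J)"
  unfolding head_sum_def[abs_def] by (intro in_L2_sum in_L2_abs d_L2)

definition large_part :: "nat \<Rightarrow> nat \<Rightarrow> 'a \<Rightarrow> real" where
  "large_part J K x = (if real K < head_sum J x then (head_sum J x)\<^sup>2 else 0)"

lemma large_part_nonneg: "0 \<le> large_part J K x"
  by (simp add: large_part_def)

lemma large_part_integrable: "integrable M (large_part J K)"
proof (rule Bochner_Integration.integrable_bound[OF in_L2_D(2)[OF head_sum_L2[of J]]])
  show "large_part J K \<in> borel_measurable M"
    unfolding large_part_def[abs_def] using in_L2_D(1)[OF head_sum_L2[of J]] by measurable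
qed (simp add: large_part_def)

lemma max_error_pathwise_bound:
  assumes n: "1 \<le> n" and I: "1 \<le> I" and J: "J \<le> p" "n \<le> p"
  shows "AE x in M. max_error X D n x \<le> (6 * (\<Sum>i<I. \<bar>a i x\<bar>)\<^sup>2 + 3 * (real J)\<^sup>2 * (real K)\<^sup>2)
      + real n * (6 * (\<Sum>i. (a (i + I) x)\<^sup>2))
      + (\<Sum>l=1..n. 3 * (real J)\<^sup>2 * large_part J K ((T ^^ l) x))
      + 12 * tail_weight J * (\<Sum>j=J..p. (piece_max p n j x)\<^sup>2 / piece_weight p j)"
proof -
  have "AE x in M. \<forall>i. X ((T ^^ i) x) = a i x + (\<Sum>l=1..i. d (i - l) ((T ^^ l) x))"
    unfolding AE_all_countable using decomp by blast
  with AE_summable_a show ?thesis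
  proof eventually_elim
    case (elim x)
    let ?R = "6 * (\<Sum>i<I. \<bar>a i x\<bar>)\<^sup>2 + 6 * (real n * (\<Sum>i=I..n. (a i x)\<^sup>2))
      + 3 * (real J)\<^sup>2 * ((real K)\<^sup>2 + (\<Sum>l=1..n. large_part J K ((T ^^ l) x)))
      + 12 * tail_weight J * (\<Sum>j=J..p. (piece_max p n j x)\<^sup>2 / piece_weight p j)"
    have bound: "((\<Sum>i=1..k. X ((T ^^ i) x)) - mart_sum D k x)\<^sup>2 \<le> ?R" if k: "k \<in> {1..n}" for k
    proof -
      have h: "(\<Sum>j<J. \<bar>piece p j y\<bar>) = head_sum J y" for y
        using J unfolding head_sum_def by (intro sum.cong) (auto simp: piece_def)
      have X: "X ((T ^^ i) x) = a i x + (\<Sum>l=1..i. piece p (i - l) ((T ^^ l) x))"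
        if "1 \<le> i" "i \<le> n" for i
      proof -
        have "(\<Sum>l=1..i. d (i - l) ((T ^^ l) x)) = (\<Sum>l=1..i. piece p (i - l) ((T ^^ l) x))"
          using that J by (intro sum.cong) (auto simp: piece_def)
        then show ?thesis using elim(2) by simp
      qed
      have "(\<Sum>i=1..k. X ((T ^^ i) x) - D ((T ^^ i) x))\<^sup>2
        \<le> 6 * (\<Sum>i<I. \<bar>a i x\<bar>)\<^sup>2 + 6 * (real n * (\<Sum>i=I..n. (a i x)\<^sup>2))
        + 3 * (real J)\<^sup>2 * ((real K)\<^sup>2 + (\<Sum>l=1..n. if real K < (\<Sum>j<J. \<bar>piece p j ((T ^^ l) x)\<bar>)
            then (\<Sum>j<J. \<bar>piece p j ((T ^^ l) x)\<bar>)\<^sup>2 else 0))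
        + 12 * (\<Sum>j=J..p. piece_weight p j) * (\<Sum>j=J..p. (MAX k\<in>{..n}. \<bar>\<Sum>l=1..k. piece p j ((T ^^ l) x)\<bar>)\<^sup>2 / piece_weight p j)"
        using k J I n X piece_sum[of p]
        by (intro pathwise_error_bound[where X="\<lambda>i. X ((T ^^ i) x)" and D="\<lambda>i. D ((T ^^ i) x)"
              and \<delta>="\<lambda>j l. piece p j ((T ^^ l) x)" and a="\<lambda>i. a i x"])
          (auto simp: piece_weight_pos)
      then show ?thesis
        unfolding h piece_weight_sum[OF J(1)] piece_max_def mart_sum_def large_part_def by (simp only: sum_subtractf)
    qed
    have le': "max_error X D n x \<le> ?R"
      unfolding max_error_def using n bound by (subst Max_le_iff) auto
    have "(\<Sum>i=I..n. (a i x)\<^sup>2) \<le> (\<Sum>i. (a (i + I) x)\<^sup>2)"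
    proof (cases "I \<le> n")
      case True
      then have "(\<Sum>i=I..n. (a i x)\<^sup>2) = (\<Sum>i=I..<Suc n. (a i x)\<^sup>2)"
        by (simp add: atLeastLessThanSuc_atLeastAtMost)
      then show ?thesis
        using suminf_tail_split[OF elim(1), of I "Suc n"] True
          suminf_nonneg[OF summable_ignore_initial_segment[OF elim(1), of "Suc n"]] by simp
    next
      case False
      then show ?thesis
        using suminf_nonneg[OF summable_ignore_initial_segment[OF elim(1), of I]] by simp
    qed
    then have le: "6 * (real n * (\<Sum>i=I..n. (a i x)\<^sup>2)) \<le> real n * (6 * (\<Sum>i. (a (i + I) x)\<^sup>2))"
      by (simp add: mult_left_mono)
    with le' show ?case
      unfolding sum_distrib_left[symmetric] distrib_left by linarith
  qed
qed

lemma max_error_cond_exp_bound: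
  assumes n: "1 \<le> n" and I: "1 \<le> I"
  shows "AE x in M. E0 (max_error X D n) x \<le> (6 * (\<Sum>i<I. \<bar>a i x\<bar>)\<^sup>2 + 3 * (real J)\<^sup>2 * (real K)\<^sup>2)
      + real n * (6 * (\<Sum>i. (a (i + I) x)\<^sup>2))
      + (\<Sum>l=1..n. E0 (\<lambda>x. 3 * (real J)\<^sup>2 * large_part J K ((T ^^ l) x) + 48 * tail_weight J * tail_energy J ((T ^^ l) x)) x)"
proof -
  \<comment> \<open>Any \<open>p\<close> above \<open>n\<close> and \<open>J\<close> would do; it disappears from the bound.\<close>
  define p where "p = n + J"
  define V where "V x = (6 * (\<Sum>i<I. \<bar>a i x\<bar>)\<^sup>2 + 3 * (real J)\<^sup>2 * (real K)\<^sup>2)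
      + real n * (6 * (\<Sum>i. (a (i + I) x)\<^sup>2))" for x
  define B where "B x = (\<Sum>l=1..n. 3 * (real J)\<^sup>2 * large_part J K ((T ^^ l) x))" for x
  define C where "C x = 12 * tail_weight J * (\<Sum>j=J..p. (piece_max p n j x)\<^sup>2 / piece_weight p j)" for x
  have a_abs: "in_L2 M (\<lambda>x. \<Sum>i<I. \<bar>a i x\<bar>)" by (intro in_L2_sum in_L2_abs a_L2)
  have V_int: "integrable M V"
    unfolding V_def[abs_def] using in_L2_D(2)[OF a_abs] a_tail_integrable[of I] by simp
  have V_F0: "V \<in> borel_measurable F0"
    unfolding V_def[abs_def] using a_F0 by measurable
  have b_int: "integrable M (\<lambda>x. 3 * (real J)\<^sup>2 * large_part J K ((T ^^ l) x))" for l
    by (intro integrable_mult_right integrable_T_pow[OF large_part_integrable])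
  have tail_energy_int: "integrable M (\<lambda>x. 48 * tail_weight J * tail_energy J ((T ^^ l) x))" for l
    by (intro integrable_mult_right integrable_T_pow[OF tail_energy_integrable])
  have B_int: "integrable M B" unfolding B_def[abs_def] by (intro Bochner_Integration.integrable_sum b_int)
  have C_int: "integrable M C" unfolding C_def[abs_def]
    by (intro integrable_mult_right Bochner_Integration.integrable_sum integrable_divide in_L2_D(2)[OF piece_max_L2])
  have "AE x in M. E0 (max_error X D n) x \<le> E0 (\<lambda>x. V x + B x + C x) x"
  proof (rule real_cond_exp_mono)
    show "AE x in M. max_error X D n x \<le> V x + B x + C x"
      unfolding V_def B_def C_def p_def using n I by (intro max_error_pathwise_bound) auto
  qed (intro max_error_integrable X_L2 D_L2 n Bochner_Integration.integrable_add V_int B_int C_int)+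
  moreover have "AE x in M. E0 (\<lambda>x. V x + B x + C x) x = E0 (\<lambda>x. V x + B x) x + E0 C x"
    by (intro real_cond_exp_add Bochner_Integration.integrable_add V_int B_int C_int)
  moreover have "AE x in M. E0 (\<lambda>x. V x + B x) x = E0 V x + E0 B x"
    by (intro real_cond_exp_add V_int B_int)
  moreover have "AE x in M. E0 V x = V x"
    by (rule real_cond_exp_F_meas[OF V_int V_F0])
  moreover have "AE x in M. E0 B x = (\<Sum>l=1..n. E0 (\<lambda>x. 3 * (real J)\<^sup>2 * large_part J K ((T ^^ l) x)) x)"
    unfolding B_def[abs_def] by (intro real_cond_exp_sum b_int)
  moreover have "AE x in M. E0 C x \<le> (\<Sum>l=1..n. E0 (\<lambda>x. 4 * (12 * tail_weight J) * tail_energy J ((T ^^ l) x)) x)"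
    unfolding C_def[abs_def] p_def using tail_weight_pos[of J] by (intro cond_exp_late_part) auto
  moreover have "AE x in M. \<forall>l. E0 (\<lambda>x. 3 * (real J)\<^sup>2 * large_part J K ((T ^^ l) x) + 48 * tail_weight J * tail_energy J ((T ^^ l) x)) x
      = E0 (\<lambda>x. 3 * (real J)\<^sup>2 * large_part J K ((T ^^ l) x)) x + E0 (\<lambda>x. 48 * tail_weight J * tail_energy J ((T ^^ l) x)) x"
    unfolding AE_all_countable by (intro allI real_cond_exp_add b_int tail_energy_int)
  ultimately show ?thesis
  proof eventually_elim
    case (elim x)
    have "E0 (max_error X D n) x \<le> V x + ((\<Sum>l=1..n. E0 (\<lambda>x. 3 * (real J)\<^sup>2 * large_part J K ((T ^^ l) x)) x)
        + (\<Sum>l=1..n. E0 (\<lambda>x. 48 * tail_weight J * tail_energy J ((T ^^ l) x)) x))"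
      using elim(1-6) by simp
    then show ?case
      unfolding V_def using elim(7) by (simp add: sum.distrib)
  qed
qed

text \<open>
  The parameters are chosen independently of \<open>n\<close>, in the order \<open>J\<close>, then \<open>I\<close> and \<open>K\<close>: \<open>J\<close> makes the mean of the
  martingale part small, \<open>I\<close> the tail of the conditional means, and \<open>K\<close> the truncated squares, whose
  coefficient involves \<open>J\<close>.
\<close>

lemma max_error_negligible:
  "AE x in M. (\<lambda>n. 1 / real n * E0 (max_error X D n) x) \<longlonglongrightarrow> 0"
  "(\<lambda>n. \<integral>x. \<bar>1 / real n * E0 (max_error X D n) x\<bar> \<partial>M) \<longlonglongrightarrow> 0"
proof -
  have ex: "\<exists>U \<psi> \<phi>. integrable M U \<and> integrable M \<psi> \<and> integrable M \<phi> \<and>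
      (AE x in M. 0 \<le> \<psi> x) \<and> (AE x in M. 0 \<le> \<phi> x) \<and> (\<integral>x. \<psi> x \<partial>M) + (\<integral>x. \<phi> x \<partial>M) \<le> \<epsilon> \<and>
      (\<forall>n\<ge>1. AE x in M. E0 (max_error X D n) x \<le> U x + real n * \<psi> x + (\<Sum>l=1..n. E0 (\<lambda>x. \<phi> ((T ^^ l) x)) x))"
    if eps: "0 < \<epsilon>" for \<epsilon> :: real
  proof -
    have "(\<lambda>J. 48 * (tail_weight J * tail_weight J)) \<longlonglongrightarrow> 48 * (0 * 0)"
      by (intro tendsto_intros tail_weight_tendsto)
    then have "eventually (\<lambda>J. 48 * (tail_weight J * tail_weight J) < \<epsilon> / 3) sequentially"
      by (rule order_tendstoD(2)) (use eps in simp)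
    then obtain J where J: "48 * (tail_weight J * tail_weight J) < \<epsilon> / 3"
      by (auto simp: eventually_sequentially)
    have "(\<lambda>I. 6 * (\<Sum>i. \<integral>x. (a (i + I) x)\<^sup>2 \<partial>M)) \<longlonglongrightarrow> 6 * 0"
      by (intro tendsto_mult tendsto_const tail_series_tendsto_0 a_sum)
    then have "eventually (\<lambda>I. 6 * (\<Sum>i. \<integral>x. (a (i + I) x)\<^sup>2 \<partial>M) < \<epsilon> / 3) sequentially"
      by (rule order_tendstoD(2)) (use eps in simp)
    then obtain I0 where "\<And>I. I0 \<le> I \<Longrightarrow> 6 * (\<Sum>i. \<integral>x. (a (i + I) x)\<^sup>2 \<partial>M) < \<epsilon> / 3"
      by (auto simp: eventually_sequentially)
    then obtain I where I: "1 \<le> I" "6 * (\<Sum>i. \<integral>x. (a (i + I) x)\<^sup>2 \<partial>M) < \<epsilon> / 3"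
      by (metis max.cobounded1 max.cobounded2)
    have "(\<lambda>K. 3 * (real J)\<^sup>2 * (\<integral>x. large_part J K x \<partial>M)) \<longlonglongrightarrow> 3 * (real J)\<^sup>2 * 0"
      unfolding large_part_def by (intro tendsto_mult tendsto_const truncation_integral_tendsto_0 head_sum_L2)
    then have "eventually (\<lambda>K. 3 * (real J)\<^sup>2 * (\<integral>x. large_part J K x \<partial>M) < \<epsilon> / 3) sequentially"
      by (rule order_tendstoD(2)) (use eps in simp)
    then obtain K where K: "3 * (real J)\<^sup>2 * (\<integral>x. large_part J K x \<partial>M) < \<epsilon> / 3"
      by (auto simp: eventually_sequentially)
    let ?U = "\<lambda>x. 6 * (\<Sum>i<I. \<bar>a i x\<bar>)\<^sup>2 + 3 * (real J)\<^sup>2 * (real K)\<^sup>2"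
    let ?\<psi> = "\<lambda>x. 6 * (\<Sum>i. (a (i + I) x)\<^sup>2)"
    let ?\<phi> = "\<lambda>x. 3 * (real J)\<^sup>2 * large_part J K x + 48 * tail_weight J * tail_energy J x"
    have "in_L2 M (\<lambda>x. \<Sum>i<I. \<bar>a i x\<bar>)" by (intro in_L2_sum in_L2_abs a_L2)
    then have "integrable M ?U" by auto
    moreover have "integrable M ?\<psi>" using a_tail_integrable by simp
    moreover have "integrable M ?\<phi>" using large_part_integrable tail_energy_integrable by simp
    moreover have "AE x in M. 0 \<le> ?\<psi> x"
      using AE_summable_a
      by eventually_elim (auto intro!: suminf_nonneg elim: summable_ignore_initial_segment)
    moreover have "AE x in M. 0 \<le> ?\<phi> x"
      using AE_summable_ratio
    proof eventually_elim
      case (elim x)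
      have "0 \<le> tail_energy J x" by (rule tail_energy_nonneg[OF elim])
      then show ?case using tail_weight_pos[of J] large_part_nonneg[of J K x] by simp
    qed
    moreover have "(\<integral>x. ?\<psi> x \<partial>M) + (\<integral>x. ?\<phi> x \<partial>M) \<le> \<epsilon>"
    proof -
      have "(\<integral>x. ?\<phi> x \<partial>M) = 3 * (real J)\<^sup>2 * (\<integral>x. large_part J K x \<partial>M) + 48 * tail_weight J * (\<integral>x. tail_energy J x \<partial>M)"
        using large_part_integrable tail_energy_integrable by simp
      also have "48 * tail_weight J * (\<integral>x. tail_energy J x \<partial>M) \<le> 48 * (tail_weight J * tail_weight J)"
        using tail_energy_integral_le[of J] tail_weight_pos[of J] by simp
      finally show ?thesis
        using I J K by (simp add: a_tail_integral)
    qed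
    moreover have "\<forall>n\<ge>1. AE x in M. E0 (max_error X D n) x
        \<le> ?U x + real n * ?\<psi> x + (\<Sum>l=1..n. E0 (\<lambda>x. ?\<phi> ((T ^^ l) x)) x)"
      using max_error_cond_exp_bound I by blast
    ultimately show ?thesis by blast
  qed
  note Z = max_error_integrable[OF X_L2 D_L2]
  have Z0: "AE x in M. 0 \<le> max_error X D n x" if "1 \<le> n" for n
    using max_error_nonneg[OF that] by simp
  show "AE x in M. (\<lambda>n. 1 / real n * E0 (max_error X D n) x) \<longlonglongrightarrow> 0"
    by (rule tendsto_zero_if_averages_bound(1)[OF Z Z0 ex])
  show "(\<lambda>n. \<integral>x. \<bar>1 / real n * E0 (max_error X D n) x\<bar> \<partial>M) \<longlonglongrightarrow> 0"
    by (rule tendsto_zero_if_averages_bound(2)[OF Z Z0 ex])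
qed

end

section \<open>Projections onto the present of a stationary process\<close>

lemma real_cond_exp_cong_sets:
  assumes "sets F = sets G"
  shows "real_cond_exp M F = real_cond_exp M G"
  using assms sets_eq_imp_space_eq[OF assms]
  by (simp add: fun_eq_iff real_cond_exp_def nn_cond_exp_def restr_to_subalg_def subalgebra_def)

lemma sets_vimage_algebra_ident:
  assumes "space F = A" "\<And>x. x \<in> A \<Longrightarrow> f x = x"
  shows "sets (vimage_algebra A f F) = sets F"
proof -
  have "f -` B \<inter> A = B" if "B \<in> sets F" for B
    using sets.sets_into_space[OF that] assms by auto
  moreover have "f \<in> A \<rightarrow> space F" using assms by auto
  ultimately show ?thesis by (auto simp: sets_vimage_algebra2)
qed

lemma iter_int_of_nat: "iter_int M T (int n) = T ^^ n"
  by (simp add: iter_int_def)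

lemma sums_L2_cong_AE:
  assumes "sums_L2 M f g" "in_L2 M g'" "AE x in M. g x = g' x"
  shows "sums_L2 M f g'"
proof -
  have f: "in_L2 M (f k)" for k using assms(1) by (simp add: sums_L2_def)
  have g: "in_L2 M g" using assms(1) by (simp add: sums_L2_def)
  have sum: "in_L2 M (\<lambda>x. \<Sum>k<n. f k x)" for n by (intro in_L2_sum f)
  have "norm_L2 M (\<lambda>x. (\<Sum>k<n. f k x) - g' x) = norm_L2 M (\<lambda>x. (\<Sum>k<n. f k x) - g x)" for n
    unfolding norm_L2_def
    using assms(3) in_L2_D(1)[OF sum] in_L2_D(1)[OF g] in_L2_D(1)[OF assms(2)]
    by (intro arg_cong[where f=sqrt] integral_cong_AE) (auto elim!: eventually_mono)
  then show ?thesis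
    using assms(1,2) by (simp add: sums_L2_def)
qed

context filtered_mpt
begin

lemma mma_error_eq: "mma_error M T F0 Y e = (\<lambda>n x. 1 / real n * E0 (max_error Y e n) x)"
  by (simp add: fun_eq_iff mma_error_def max_error_def[abs_def] mart_sum_def partial_sum_def
      stat_seq_def iter_int_of_nat)

lemma mma_witness_iff:
  assumes Y: "in_L2 M Y"
  shows "mma_witness M T F0 Y e \<longleftrightarrow>
    e \<in> borel_measurable F0 \<and> in_L2 M e \<and> (AE x in M. E0 (\<lambda>x. e (T x)) x = 0) \<and>
    (AE x in M. (\<lambda>n. 1 / real n * E0 (max_error Y e n) x) \<longlonglongrightarrow> 0) \<and>
    (\<lambda>n. \<integral>x. \<bar>1 / real n * E0 (max_error Y e n) x\<bar> \<partial>M) \<longlonglongrightarrow> 0"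
proof -
  have "integrable M (\<lambda>x. 1 / real n * E0 (max_error Y e n) x)" if "in_L2 M e" for n
  proof (cases "n = 0")
    case False
    then show ?thesis
      using real_cond_exp_int(1)[OF max_error_integrable[OF Y that, of n]] by simp
  qed simp
  then show ?thesis
    unfolding mma_witness_def mma_error_eq tendsto_L1_def comp_def by auto
qed

end

text \<open>
  The bijectivity of \<open>T\<close> enters through the algebra \<open>T(F0)\<close>, here \<open>past\<close>, which defines \<open>P\<^sub>0\<close>.
\<close>

locale adapted_process = filtered_mpt M F0 T
  for M F0 :: "'a measure" and T :: "'a \<Rightarrow> 'a" +
  fixes X :: "'a \<Rightarrow> real"
  assumes bij: "bij_betw T (space M) (space M)"
    and inv_measurable: "the_inv_into (space M) T \<in> M \<rightarrow>\<^sub>M M"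
    and X_F0: "X \<in> borel_measurable F0"
    and X_L2: "in_L2 M X"
begin

abbreviation past :: "'a measure" where
  "past \<equiv> filt M T F0 (-1)"

abbreviation X' :: "nat \<Rightarrow> 'a \<Rightarrow> real" where
  "X' j \<equiv> stat_seq M T X (int j)"

lemma X'_eq: "X' j = (\<lambda>x. X ((T ^^ j) x))"
  by (simp add: stat_seq_def iter_int_of_nat comp_def)

lemma past_eq: "past = vimage_algebra (space M) (the_inv_into (space M) T) F0"
  by (simp add: filt_def iter_int_def funpow.simps(2))

lemma subalgebra_past: "subalgebra M past"
  unfolding past_eq by (rule subalgebra_vimage_algebra[OF subalg inv_measurable])

lemma sets_vimage_past: "sets (vimage_algebra (space M) T past) = sets F0"
proof -
  have "vimage_algebra (space M) T past = vimage_algebra (space M) (\<lambda>x. the_inv_into (space M) T (T x)) F0"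
    unfolding past_eq using measurable_space[OF T] measurable_space[OF inv_measurable] space_F0
    by (intro vimage_algebra_vimage_algebra_eq) auto
  also have "sets \<dots> = sets F0"
    using bij by (intro sets_vimage_algebra_ident space_F0)
      (auto simp: bij_betw_def the_inv_into_f_f)
  finally show ?thesis .
qed

lemma sets_past_le: "sets past \<subseteq> sets F0"
proof
  let ?S = "the_inv_into (space M) T"
  have S: "?S \<in> space M \<rightarrow> space F0"
    using measurable_space[OF inv_measurable] space_F0 by auto
  fix A assume "A \<in> sets past"
  then obtain B where B: "B \<in> sets F0" "A = ?S -` B \<inter> space M"
    unfolding past_eq sets_vimage_algebra2[OF S] by auto
  have "T \<in> space M \<rightarrow> space F0" using measurable_space[OF T] space_F0 by auto
  then obtain C where C: "C \<in> sets F0" "B = T -` C \<inter> space M"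
    using B(1) increasing by (auto simp: sets_vimage_algebra2)
  have "T (?S x) = x" if "x \<in> space M" for x
    using bij that by (simp add: bij_betw_def f_the_inv_into_f)
  then have "A = C"
    unfolding B(2) C(2) using S sets.sets_into_space[OF C(1)] space_F0 by auto
  then show "A \<in> sets F0" using C(1) by simp
qed

definition a :: "nat \<Rightarrow> 'a \<Rightarrow> real" where
  "a j = E0 (X' j)"

definition d :: "nat \<Rightarrow> 'a \<Rightarrow> real" where
  "d j = proj0 M T F0 (X' j)"

lemma X'_L2: "in_L2 M (X' j)"
  unfolding X'_eq by (rule in_L2_T_pow[OF X_L2])

lemma a_L2: "in_L2 M (a j)"
  unfolding a_def by (rule in_L2_cond_exp[OF X'_L2])

lemma d_L2: "in_L2 M (d j)"
proof -
  interpret P: finite_measure_subalgebra M past by unfold_locales (rule subalgebra_past)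
  show ?thesis
    unfolding d_def proj0_def[abs_def]
    by (intro in_L2_diff in_L2_cond_exp P.in_L2_cond_exp X'_L2)
qed

lemma d_F0: "d j \<in> borel_measurable F0"
proof -
  have "subalgebra F0 past"
    using sets_past_le by (simp add: subalgebra_def space_F0 past_eq)
  then have "real_cond_exp M past (X' j) \<in> borel_measurable F0"
    by (rule measurable_from_subalg) simp
  then show ?thesis
    unfolding d_def proj0_def[abs_def] by measurable
qed

lemma X'_T: "X' j (T x) = X' (Suc j) x"
  by (simp only: X'_eq funpow_Suc_right comp_def)

lemma a_0: "AE x in M. a 0 x = X x"
  unfolding a_def X'_eq using real_cond_exp_F_meas[OF integrable_L2[OF X_L2] X_F0] by simp

text \<open>
  Conditioning \<open>X\<^sub>j\<close> on the past and then moving by \<open>T\<close> amounts to conditioning \<open>X\<^sub>j\<^sub>+\<^sub>1\<close> on \<open>F0\<close>, because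
  \<open>T\<^sup>-\<^sup>1(past) = F0\<close>. Writing \<open>d j \<circ> T\<close> as a difference of conditional means gives both the
  martingale property and the expansion of \<open>X\<^sub>i\<close>.
\<close>

lemma d_T: "AE x in M. d j (T x) = a j (T x) - a (Suc j) x"
proof -
  have "AE x in M. real_cond_exp M (vimage_algebra (space M) T past) (\<lambda>x. X' j (T x)) x
      = real_cond_exp M past (X' j) (T x)"
    by (rule cond_exp_compose[OF subalgebra_past T distr_T integrable_L2[OF X'_L2]])
  then show ?thesis
    unfolding real_cond_exp_cong_sets[OF sets_vimage_past] X'_T
    by eventually_elim (simp add: d_def proj0_def a_def)
qed

lemma d_diff: "AE x in M. E0 (\<lambda>x. d j (T x)) x = 0"
proof -
  have int_a: "integrable M (a j)" for j by (rule integrable_L2[OF a_L2])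
  have int_aT: "integrable M (\<lambda>x. a j (T x))"
    by (rule integrable_compose[OF T distr_T int_a])
  have int_dT: "integrable M (\<lambda>x. d j (T x))"
    by (rule integrable_compose[OF T distr_T integrable_L2[OF d_L2]])
  have "AE x in M. E0 (\<lambda>x. d j (T x)) x = E0 (\<lambda>x. a j (T x) - a (Suc j) x) x"
    using int_a int_aT int_dT by (intro real_cond_exp_cong d_T) auto
  moreover have "AE x in M. E0 (\<lambda>x. a j (T x) - a (Suc j) x) x = E0 (\<lambda>x. a j (T x)) x - E0 (a (Suc j)) x"
    by (intro real_cond_exp_diff int_aT int_a)
  moreover have "AE x in M. E0 (\<lambda>x. a j (T x)) x = a (Suc j) x"
    using cond_exp_cond_exp_T[OF integrable_L2[OF X'_L2[of j]]] unfolding X'_T by (simp add: a_def)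
  moreover have "AE x in M. E0 (a (Suc j)) x = a (Suc j) x"
    by (rule real_cond_exp_F_meas[OF int_a]) (simp add: a_def)
  ultimately show ?thesis by eventually_elim simp
qed

text \<open>
  The sum over \<open>l\<close> telescopes from \<open>a i\<close> at time \<open>0\<close> to \<open>a 0 = X\<close> at time \<open>i\<close>.
\<close>

lemma decomp: "AE x in M. X ((T ^^ i) x) = a i x + (\<Sum>l=1..i. d (i - l) ((T ^^ l) x))"
proof -
  have "AE x in M. \<forall>j l. d j ((T ^^ Suc l) x) = a j ((T ^^ Suc l) x) - a (Suc j) ((T ^^ l) x)"
    unfolding AE_all_countable
  proof (intro allI)
    fix j l
    show "AE x in M. d j ((T ^^ Suc l) x) = a j ((T ^^ Suc l) x) - a (Suc j) ((T ^^ l) x)"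
      using AE_T_pow[OF d_T[of j], of l] by (simp add: funpow.simps(2))
  qed
  with AE_T_pow[OF a_0, of i] show ?thesis
  proof eventually_elim
    case (elim x)
    define b where "b l = a (i - l) ((T ^^ l) x)" for l
    have "(\<Sum>l=1..i. d (i - l) ((T ^^ l) x)) = (\<Sum>l=1..i. b l - b (l - 1))"
    proof (rule sum.cong)
      fix l assume "l \<in> {1..i}"
      then obtain m where "l = Suc m" "Suc (i - Suc m) = i - m" by (cases l) auto
      then show "d (i - l) ((T ^^ l) x) = b l - b (l - 1)"
        using elim(2) by (simp add: b_def)
    qed simp
    also have "\<dots> = b i - b 0"
      by (induction i) auto
    finally show ?case using elim(1) by (simp add: b_def)
  qed
qed

end

section \<open>The maximal martingale approximation\<close>

theorem proposition4p1:
  fixes M F0 :: "'a measure" and T :: "'a \<Rightarrow> 'a" and X0 :: "'a \<Rightarrow> real"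
  assumes "prob_space M"
    and "bimeasurable_mpt M T"
    and "subalgebra M F0"
    and "sets F0 \<subseteq> sets (vimage_algebra (space M) T F0)"
    and "X0 \<in> borel_measurable F0"
    and "in_L2 M X0"
    and "(\<integral>x. X0 x \<partial>M) = 0"
    and "summable (\<lambda>k. (norm_L2 M (real_cond_exp M F0 (stat_seq M T X0 (int k))))\<^sup>2)"
    and "AE x in M. real_cond_exp M (filt_minus_inf M T F0) X0 x = 0"
    and "summable (\<lambda>k. norm_L2 M (proj0 M T F0 (stat_seq M T X0 (int k))))"
  shows "L20_MMA M T F0 X0 \<and>
    (\<forall>D. mma_witness M T F0 X0 D \<longrightarrow>
       sums_L2 M (\<lambda>k. proj0 M T F0 (stat_seq M T X0 (int k))) D)"
proof -
  interpret prob_space M by fact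
  interpret A: adapted_process M F0 T X0
    using assms by unfold_locales (auto simp: bimeasurable_mpt_def)
  interpret H: hannan_decomposition M F0 T X0 A.a A.d
  proof unfold_locales
    show "A.a j \<in> borel_measurable F0" for j by (simp add: A.a_def)
    show "summable (\<lambda>j. \<integral>x. (A.a j x)\<^sup>2 \<partial>M)"
      using assms(8) by (simp add: norm_L2_power2 A.a_def)
    show "summable (\<lambda>j. norm_L2 M (A.d j))"
      using assms(10) by (simp add: A.d_def)
  qed (fact A.X_L2 A.a_L2 A.d_F0 A.d_L2 A.d_diff A.decomp)+
  have witness: "mma_witness M T F0 X0 H.D"
    unfolding A.mma_witness_iff[OF A.X_L2]
    using H.D_F0 H.D_L2 H.D_diff H.max_error_negligible by blast
  have "sums_L2 M A.d D" if "mma_witness M T F0 X0 D" for D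
  proof (rule sums_L2_cong_AE[OF H.sums_L2_D])
    from that show "in_L2 M D" by (simp add: mma_witness_def)
    from that witness show "AE x in M. H.D x = D x"
      unfolding A.mma_witness_iff[OF A.X_L2]
      by (blast intro: A.martingale_approximation_unique[OF A.X_L2])
  qed
  with witness show ?thesis
    unfolding L20_MMA_def A.d_def by blast
qed

end
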